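(* Let $V_0>0$ and let $F:(0,\infty)\to\mathbb{R}$ be a smooth function with $F'>0$ and $F(1)=0$. If $(u_e,\Omega_e)$ is a (classical) steady state, in dimension $n=2$, of the droplet system described in the context, then $\Omega_e$ must be a disc (its boundary is a circle) of radius $$ r_e=\sqrt[3]{\frac{4V_0}{\pi}}, $$ and $$ u_e=\frac12\Bigl(r_e-\frac{r^2}{r_e}\Bigr), $$ where $r$ is the distance from the center of the disc. The parameter $\lambda$ satisfies $\lambda=2/r_e$.
   Context: The droplet system for the unknown family of planar domains $\Omega(t)\subset\mathbb{R}^2$, the height $u(\cdot,t):\Omega(t)\to\mathbb{R}$ and the number $\lambda=\lambda(t)\in\mathbb{R}$ is $$-\Delta u=\lambda \text{ in }\Omega(t),\quad u=0\text{ on }\partial\Omega(t),\quad \int_{\Omega(t)}u\,dx=V_0,\quad V=F(|\nabla u|)\text{ on }\partial\Omega(t),\quad \Omega(0)=\Omega_0,$$ where $V$ is the velocity of $\partial\Omega(t)$ in the outward normal direction. A (classical) steady state is a pair $(u_e,\Omega_e)$, where $\Omega_e\subset\mathbb{R}^2$ is a bounded connected open set with boundary of class $C^2$ and $u_e\in C^2(\overline{\Omega_e})$, such that for some $\lambda\in\mathbb{R}$: $-\Delta u_e=\lambda$ in $\Omega_e$, $u_e=0$ on $\partial\Omega_e$, $\int_{\Omega_e}u_e\,dx=V_0$, and the front velocity vanishes, i.e. $F(|\nabla u_e|)=0$ on $\partial\Omega_e$. *)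

theory Defs
  imports "HOL-Analysis.Analysis"
begin

(* Functions of class C^k of one real variable.  Meant for open S, since the iterated "deriv"
   is the two-sided derivative. *)
definition Ck_on :: "nat \<Rightarrow> (real \<Rightarrow> real) \<Rightarrow> real set \<Rightarrow> bool" where
  "Ck_on k f S \<longleftrightarrow>
     (\<forall>i<k. (deriv ^^ i) f differentiable_on S) \<and> continuous_on S ((deriv ^^ k) f)"

definition smooth_on :: "(real \<Rightarrow> real) \<Rightarrow> real set \<Rightarrow> bool" where
  "smooth_on f S \<longleftrightarrow> (\<forall>k. Ck_on k f S)"

(* Near each boundary point, in Cartesian coordinates (x \<bullet> e, x \<bullet> n) given by some
   orthonormal frame, the domain is the part of a ball above the graph of a C^2 function. *)
definition C2_boundary :: "(real^2) set \<Rightarrow> bool" where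
  "C2_boundary \<Omega> \<longleftrightarrow>
     (\<forall>p \<in> frontier \<Omega>. \<exists>\<rho> e n \<gamma>. \<rho> > 0 \<and> norm e = 1 \<and> norm n = 1 \<and> e \<bullet> n = 0 \<and>
        Ck_on 2 \<gamma> UNIV \<and>
        \<Omega> \<inter> ball p \<rho> = {x \<in> ball p \<rho>. x \<bullet> n > \<gamma> (x \<bullet> e)})"

(* u belongs to C^2 of the closure of the open set \<Omega>: u, its gradient Du and its Hessian D2u
   extend continuously from \<Omega> to the closure.  On the closure Du and D2u are determined by u;
   at boundary points they are the limits of the derivatives taken inside \<Omega>.  The values of
   u, Du and D2u outside the closure are irrelevant. *)
definition C2_closure ::
    "(real^2) set \<Rightarrow> (real^2 \<Rightarrow> real) \<Rightarrow> (real^2 \<Rightarrow> real^2) \<Rightarrow> (real^2 \<Rightarrow> real^2^2) \<Rightarrow> bool" where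
  "C2_closure \<Omega> u Du D2u \<longleftrightarrow>
     continuous_on (closure \<Omega>) u \<and>
     continuous_on (closure \<Omega>) Du \<and>
     continuous_on (closure \<Omega>) D2u \<and>
     (\<forall>x\<in>\<Omega>. GDERIV u x :> Du x \<and> (Du has_derivative (\<lambda>h. D2u x *v h)) (at x))"

(* (u, \<Omega>) is a classical steady state with parameter lam.  The Laplacian is the trace of the
   Hessian.  F is a function on (0,\<infinity>) only, so the equation F(|Du|) = 0 includes
   that |Du| lies in the domain of F; this keeps the value of the total HOL function F at 0
   from playing any role. *)
definition steady_state ::
    "(real \<Rightarrow> real) \<Rightarrow> real \<Rightarrow> real \<Rightarrow> (real^2 \<Rightarrow> real) \<Rightarrow> (real^2) set \<Rightarrow> bool" where
  "steady_state F V0 lam u \<Omega> \<longleftrightarrow>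
     bounded \<Omega> \<and> connected \<Omega> \<and> open \<Omega> \<and> C2_boundary \<Omega> \<and>
     (\<exists>Du D2u. C2_closure \<Omega> u Du D2u \<and>
        (\<forall>x\<in>\<Omega>. - trace (D2u x) = lam) \<and>
        (\<forall>x\<in>frontier \<Omega>. u x = 0) \<and>
        (LINT x:\<Omega>|lebesgue. u x) = V0 \<and>
        (\<forall>x\<in>frontier \<Omega>. norm (Du x) \<in> {0<..} \<and> F (norm (Du x)) = 0))"

end

theory Submission
  imports Defs "HOL-Complex_Analysis.Complex_Analysis"
begin

text \<open>Weinberger's argument. Since \<open>F\<close> is strictly increasing, \<open>\<bar>Du\<bar> = 1\<close> on the boundary, and
  \<open>P = \<bar>Du\<bar>\<^sup>2 + lam * u\<close> equals \<open>1\<close> there. The divergences of \<open>u Du\<close> and of the Pohozaev field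
  \<open>(x \<bullet> Du) Du + (lam u - \<bar>Du\<bar>\<^sup>2 / 2 - 1 / 2) x\<close> have integral \<open>0\<close>, because both fields are orthogonal
  to \<open>Du\<close> on the boundary; their sum says that \<open>P - 1\<close> has integral \<open>0\<close>. Hence \<open>P\<close> cannot be
  smaller than \<open>1\<close> throughout the domain and attains its maximum at an interior point. In the plane
  \<open>G = (u\<^sub>x + lam x / 2) - \<i> (u\<^sub>y + lam y / 2)\<close> is holomorphic and \<open>P\<close> is \<open>\<bar>G\<bar>\<^sup>2\<close> plus a harmonic
  function, so an interior maximum forces \<open>G\<close> to be constant. Then \<open>u + lam \<bar>x - c\<bar>\<^sup>2 / 4\<close> is constant
  for some \<open>c\<close>, and the domain is a disc of radius \<open>2 / lam\<close>. The Pohozaev identity,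
  \<open>2 lam \<integral>u\<close> = area, gives the radius.\<close>

subsection \<open>Integrals of divergences\<close>

lemma gderiv_along_line:
  assumes "GDERIV u (x + s *\<^sub>R v) :> g"
  shows "((\<lambda>s. u (x + s *\<^sub>R v)) has_real_derivative v \<bullet> g) (at s)"
proof -
  have 1: "((\<lambda>s. x + s *\<^sub>R v) has_derivative (\<lambda>h. h *\<^sub>R v)) (at s)"
    by (auto intro!: derivative_eq_intros)
  have "(\<lambda>h. (h *\<^sub>R v) \<bullet> g) = (*) (v \<bullet> g)"
    by (auto simp: fun_eq_iff)
  then show ?thesis
    using has_derivative_compose[OF 1 assms[unfolded gderiv_def]]
    by (simp add: has_field_derivative_def)
qed

text \<open>The second difference \<open>Q\<close> of \<open>u\<close> over the parallelogram
  spanned by \<open>t *\<^sub>R v\<close> and \<open>t *\<^sub>R w\<close> is symmetric in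
  \<open>v\<close> and \<open>w\<close>. Up to an error of order e t^2 it equals t^2 times
  \<open>v \<bullet> D w\<close>, and this needs differentiability of the gradient at the single
  point \<open>p\<close> only.\<close>

lemma second_derivative_symmetric:
  fixes u :: "'a::real_inner \<Rightarrow> real"
  assumes "open S" "p \<in> S"
    and grad: "\<And>x. x \<in> S \<Longrightarrow> GDERIV u x :> G x"
    and hess: "(G has_derivative D) (at p)"
  shows "v \<bullet> D w = w \<bullet> D v"
proof -
  define C where "C = norm v + norm w + 1"
  have C: "C > 0"
    using norm_ge_zero[of v] norm_ge_zero[of w] unfolding C_def by linarith
  have D: "linear D"
    using hess by (rule has_derivative_linear)
  have "\<bar>v \<bullet> D w - w \<bullet> D v\<bar> \<le> e" if "e > 0" for e
  proof -
    \<comment> \<open>Scaled so that two errors of size 2 e' C^2 t^2 add up to e t^2.\<close>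
    define e' where "e' = e / (4 * C\<^sup>2)"
    have e': "e' > 0"
      using that C by (simp add: e'_def)
    obtain d0 where d0: "d0 > 0"
      "\<And>y. norm (y - p) < d0 \<Longrightarrow> norm (G y - G p - D (y - p)) \<le> e' * norm (y - p)"
      using hess e' unfolding has_derivative_at_alt by blast
    obtain d1 where d1: "d1 > 0" "ball p d1 \<subseteq> S"
      using assms(1,2) openE by blast
    define d where "d = min d0 d1"
    \<comment> \<open>Then t C = d/2, so the whole parallelogram lies inside \<open>S\<close> and
      inside the ball where the expansion of \<open>G\<close> holds.\<close>
    define t where "t = d / (2 * C)"
    have d: "d > 0" and t: "t > 0"
      using d0(1) d1(1) C by (auto simp: d_def t_def)
    have tC: "t * C < d"
      using d C by (simp add: t_def)
    define Q where "Q a b = u (p + t *\<^sub>R a + t *\<^sub>R b) - u (p + t *\<^sub>R a) - u (p + t *\<^sub>R b) + u p" for a b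
    have key: "\<bar>Q a b - t\<^sup>2 * (a \<bullet> D b)\<bar> \<le> 2 * e' * C\<^sup>2 * t\<^sup>2" if ab: "norm a + norm b \<le> C" for a b
    proof -
      have small: "norm (s *\<^sub>R a + r *\<^sub>R b) \<le> t * C" if "0 \<le> s" "s \<le> t" "0 \<le> r" "r \<le> t" for s r
      proof -
        have "norm (s *\<^sub>R a + r *\<^sub>R b) \<le> s * norm a + r * norm b"
          using norm_triangle_ineq[of "s *\<^sub>R a" "r *\<^sub>R b"] that by simp
        also have "\<dots> \<le> t * norm a + t * norm b"
          using that by (intro add_mono mult_right_mono) auto
        also have "\<dots> \<le> t * C"
          using ab t by (simp flip: distrib_left)
        finally show ?thesis .
      qed
      have inS: "p + (s *\<^sub>R a + r *\<^sub>R b) \<in> S" if "0 \<le> s" "s \<le> t" "0 \<le> r" "r \<le> t" for s r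
      proof -
        have "dist p (p + (s *\<^sub>R a + r *\<^sub>R b)) < d1"
          using small[OF that] tC by (simp add: dist_norm d_def del: minus_add_distrib)
        then show ?thesis
          using d1(2) by auto
      qed
      have Gb: "norm (G (p + (s *\<^sub>R a + r *\<^sub>R b)) - G p - D (s *\<^sub>R a + r *\<^sub>R b)) \<le> e' * (t * C)"
        if "0 \<le> s" "s \<le> t" "0 \<le> r" "r \<le> t" for s r
      proof -
        have "norm (G (p + (s *\<^sub>R a + r *\<^sub>R b)) - G p - D (s *\<^sub>R a + r *\<^sub>R b)) \<le> e' * norm (s *\<^sub>R a + r *\<^sub>R b)"
          using d0(2)[of "p + (s *\<^sub>R a + r *\<^sub>R b)"] small[OF that] tC by (auto simp: d_def)
        also have "\<dots> \<le> e' * (t * C)"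
          using small[OF that] e' by (intro mult_left_mono) auto
        finally show ?thesis .
      qed
      \<comment> \<open>One difference is taken in direction \<open>b\<close>; the mean value
        theorem in direction \<open>a\<close> turns the other into a difference of gradients, to
        which the expansion at \<open>p\<close> applies twice.\<close>
      define \<phi> where "\<phi> s = u (p + t *\<^sub>R b + s *\<^sub>R a) - u (p + s *\<^sub>R a)" for s
      have d\<phi>: "(\<phi> has_real_derivative a \<bullet> G (p + t *\<^sub>R b + s *\<^sub>R a) - a \<bullet> G (p + s *\<^sub>R a)) (at s)"
        if "0 \<le> s" "s \<le> t" for s
        unfolding \<phi>_def
        using inS[of s t] inS[of s 0] that t
        by (intro DERIV_diff gderiv_along_line grad) (auto simp: algebra_simps)
      obtain s where s: "0 < s" "s < t"
        "\<phi> t - \<phi> 0 = (t - 0) * (a \<bullet> G (p + t *\<^sub>R b + s *\<^sub>R a) - a \<bullet> G (p + s *\<^sub>R a))"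
        using MVT2[of 0 t \<phi>, OF t d\<phi>] by blast
      define E1 where "E1 = G (p + (s *\<^sub>R a + t *\<^sub>R b)) - G p - D (s *\<^sub>R a + t *\<^sub>R b)"
      define E0 where "E0 = G (p + (s *\<^sub>R a + 0 *\<^sub>R b)) - G p - D (s *\<^sub>R a + 0 *\<^sub>R b)"
      have "Q a b = \<phi> t - \<phi> 0"
        by (simp add: Q_def \<phi>_def algebra_simps)
      also have "\<dots> = t * (a \<bullet> (E1 - E0 + t *\<^sub>R D b))"
        using s(3) by (simp add: E1_def E0_def linear_add[OF D] linear_scale[OF D] inner_diff_right inner_add_right
            algebra_simps)
      finally have "Q a b - t\<^sup>2 * (a \<bullet> D b) = t * (a \<bullet> (E1 - E0))"
        by (simp add: algebra_simps power2_eq_square inner_diff_right inner_add_right)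
      also have "\<bar>\<dots>\<bar> \<le> t * (C * (2 * (e' * (t * C))))"
      proof -
        have "norm (E1 - E0) \<le> 2 * (e' * (t * C))"
          using norm_triangle_ineq4[of E1 E0] Gb[of s t] Gb[of s 0] s(1,2)
          unfolding E1_def E0_def by (smt (verit))
        moreover have "norm a \<le> C"
          using ab norm_ge_zero[of b] by linarith
        ultimately have "norm a * norm (E1 - E0) \<le> C * (2 * (e' * (t * C)))"
          using C by (intro mult_mono) auto
        then have "\<bar>a \<bullet> (E1 - E0)\<bar> \<le> C * (2 * (e' * (t * C)))"
          using Cauchy_Schwarz_ineq2[of a "E1 - E0"] by linarith
        then show ?thesis
          using t by (simp add: abs_mult)
      qed
      finally show ?thesis
        by (simp add: power2_eq_square mult_ac)
    qed
    have "Q v w = Q w v"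
      by (simp add: Q_def algebra_simps)
    then have "t\<^sup>2 * \<bar>v \<bullet> D w - w \<bullet> D v\<bar> = \<bar>(Q w v - t\<^sup>2 * (w \<bullet> D v)) - (Q v w - t\<^sup>2 * (v \<bullet> D w))\<bar>"
      by (simp add: abs_mult flip: right_diff_distrib)
    also have "\<dots> \<le> 4 * e' * C\<^sup>2 * t\<^sup>2"
      using key[of v w] key[of w v] by (auto simp: C_def)
    also have "\<dots> = t\<^sup>2 * e"
      using C by (simp add: e'_def)
    finally show ?thesis
      using t by simp
  qed
  then have "\<bar>v \<bullet> D w - w \<bullet> D v\<bar> \<le> 0"
    by (meson dense_ge)
  then show ?thesis
    by simp
qed

text \<open>By translation invariance all difference quotients have integral \<open>0\<close>.\<close>

lemma integral_directional_derivative: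
  fixes f d :: "'a::euclidean_space \<Rightarrow> real"
  assumes cont: "continuous_on UNIV f"
    and supp: "bounded S" "\<And>x. x \<notin> S \<Longrightarrow> f x = 0"
    and deriv: "\<And>x. ((\<lambda>t. f (x + t *\<^sub>R e)) has_real_derivative d x) (at 0)"
    and bound: "\<And>x. \<bar>d x\<bar> \<le> L"
  shows "integral\<^sup>L lborel d = 0" "integrable lborel d"
proof -
  obtain R where R: "S \<subseteq> cball 0 R"
    using supp(1) by (auto simp: bounded_iff subset_iff)
  \<comment> \<open>Nonzero steps of size at most 1, so every shifted support stays in the ball of
    radius R + |e|.\<close>
  define t :: "nat \<Rightarrow> real" where "t n = 1 / Suc n" for n
  have t: "t n > 0" "t n \<le> 1" for n
    by (auto simp: t_def)
  have t0: "t \<longlonglongrightarrow> 0"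
    unfolding t_def by real_asymp
  have lim: "(\<lambda>n. (f (x + t n *\<^sub>R e) - f x) / t n) \<longlonglongrightarrow> d x" for x
  proof -
    have "((\<lambda>h. (f (x + h *\<^sub>R e) - f x) / h) \<longlongrightarrow> d x) (at 0)"
      using deriv[of x] by (simp add: DERIV_def)
    moreover have "filterlim t (at 0) sequentially"
      using t0 t(1) by (auto simp: filterlim_at intro!: always_eventually) (metis less_irrefl)
    ultimately show ?thesis
      by (rule filterlim_compose)
  qed
  have f[measurable]: "f \<in> borel_measurable borel"
    using cont by (rule borel_measurable_continuous_onI)
  have int_f: "integrable lborel f"
  proof -
    have "integrable lborel (\<lambda>x. indicator (cball 0 R) x *\<^sub>R f x)"
      by (rule borel_integrable_compact) (auto intro: continuous_on_subset[OF cont])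
    also have "(\<lambda>x. indicator (cball 0 R) x *\<^sub>R f x) = f"
    proof
      show "indicator (cball 0 R) x *\<^sub>R f x = f x" for x
        by (cases "x \<in> S") (use supp(2) R in \<open>auto simp: indicator_def\<close>)
    qed
    finally show ?thesis .
  qed
  have shift: "integrable lborel (\<lambda>x. f (x + c))" "(LINT x|lborel. f (x + c)) = integral\<^sup>L lborel f" for c
  proof -
    have "integrable (distr lborel borel ((+) c)) f"
      unfolding lborel_distr_plus using int_f .
    then show "integrable lborel (\<lambda>x. f (x + c))"
      using integrable_distr[of "(+) c" lborel borel f] by (simp add: add.commute)
    have "integral\<^sup>L (distr lborel borel ((+) c)) f = (LINT x|lborel. f (c + x))"
      by (rule integral_distr) auto
    then show "(LINT x|lborel. f (x + c)) = integral\<^sup>L lborel f"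
      by (simp add: lborel_distr_plus add.commute)
  qed
  \<comment> \<open>The dominating function: inside the enlarged ball the mean value theorem gives
    the bound \<open>L\<close>; outside it both x and the shifted point avoid the support.\<close>
  have bd: "norm ((f (x + t n *\<^sub>R e) - f x) / t n) \<le> L * indicator (cball 0 (R + norm e)) x" for x n
  proof (cases "x \<in> cball 0 (R + norm e)")
    case True
    have "((\<lambda>s. f (x + s *\<^sub>R e)) has_real_derivative d (x + s *\<^sub>R e)) (at s)" for s
      using deriv[of "x + s *\<^sub>R e"] DERIV_shift[of "\<lambda>s. f (x + s *\<^sub>R e)" "d (x + s *\<^sub>R e)" 0 s]
      by (simp add: algebra_simps)
    then have "norm (f (x + t n *\<^sub>R e) - f (x + 0 *\<^sub>R e)) \<le> L * norm (t n - 0)"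
      by (intro field_differentiable_bound[of UNIV "\<lambda>s. f (x + s *\<^sub>R e)" "\<lambda>s. d (x + s *\<^sub>R e)"])
        (auto simp: bound)
    then show ?thesis
      using True t(1)[of n] by (simp add: field_simps)
  next
    case False
    then have nx: "norm x > R + norm e"
      by simp
    moreover have "norm (x + t n *\<^sub>R e) \<ge> norm x - norm (t n *\<^sub>R e)"
      by (rule norm_diff_ineq)
    moreover have "norm (t n *\<^sub>R e) \<le> norm e"
      using t[of n] by (simp add: mult_left_le_one_le)
    ultimately have "\<not> norm x \<le> R" "\<not> norm (x + t n *\<^sub>R e) \<le> R"
      using norm_ge_zero[of e] by linarith+
    then have "x \<notin> S" "x + t n *\<^sub>R e \<notin> S"
      using R by (auto dest!: subsetD)
    then show ?thesis
      using False supp(2) by simp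
  qed
  have dom: "integrable lborel (\<lambda>x. L * indicator (cball 0 (R + norm e)) x :: real)"
    by (intro integrable_mult_right integrable_real_indicator emeasure_bounded_finite) auto
  \<comment> \<open>\<open>d\<close> is not assumed continuous; it is measurable as the limit of the
    quotients.\<close>
  have d[measurable]: "d \<in> borel_measurable lborel"
    by (rule borel_measurable_LIMSEQ_real[OF lim]) auto
  have z: "(LINT x|lborel. (f (x + t n *\<^sub>R e) - f x) / t n) = 0" for n
    using shift[of "t n *\<^sub>R e"] int_f by simp
  have "(\<lambda>n. LINT x|lborel. (f (x + t n *\<^sub>R e) - f x) / t n) \<longlonglongrightarrow> integral\<^sup>L lborel d"
    by (rule integral_dominated_convergence[OF _ _ dom]) (use lim bd in auto)
  then show "integral\<^sup>L lborel d = 0"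
    unfolding z by (simp add: LIMSEQ_const_iff)
  show "integrable lborel d"
    by (rule integrable_dominated_convergence[OF _ _ dom, where s = "\<lambda>n x. (f (x + t n *\<^sub>R e) - f x) / t n"])
      (use lim bd in auto)
qed

section \<open>Divergence theorem for compactly supported fields, and a cutoff function\<close>

text \<open>The trace of a linear map, taken on functions so that a Frechet derivative can be
  inserted directly: \<open>tr (W' x)\<close> is the divergence of \<open>W\<close> at x.\<close>

definition tr :: "('a::euclidean_space \<Rightarrow> 'a) \<Rightarrow> real" where
  "tr D = (\<Sum>b\<in>Basis. D b \<bullet> b)"

text \<open>Each diagonal entry \<open>W' x b \<bullet> b\<close> is the derivative along
  \<open>b\<close> of one component of \<open>W\<close>, so its integral is 0 by translation
  invariance. Bounds are required of these entries alone.\<close>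

lemma integral_divergence_compact_support:
  fixes W :: "'a::euclidean_space \<Rightarrow> 'a"
  assumes W: "\<And>x. (W has_derivative W' x) (at x)"
    and supp: "bounded S" "\<And>x. x \<notin> S \<Longrightarrow> W x = 0"
    and bound: "\<And>b. b \<in> Basis \<Longrightarrow> bounded (range (\<lambda>x. W' x b \<bullet> b))"
  shows "(LINT x|lborel. tr (W' x)) = 0" "integrable lborel (\<lambda>x. tr (W' x))"
proof -
  have "(LINT x|lborel. W' x b \<bullet> b) = 0 \<and> integrable lborel (\<lambda>x. W' x b \<bullet> b)" if b: "b \<in> Basis" for b
  proof -
    obtain L where L: "\<And>x. \<bar>W' x b \<bullet> b\<bar> \<le> L"
      using bound[OF b] by (auto simp: bounded_iff)
    have cont: "continuous_on UNIV (\<lambda>x. W x \<bullet> b)"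
      using W by (intro continuous_intros continuous_at_imp_continuous_on ballI has_derivative_continuous)
    have deriv: "((\<lambda>t. W (x + t *\<^sub>R b) \<bullet> b) has_real_derivative W' x b \<bullet> b) (at 0)" for x
    proof -
      have "((\<lambda>t. x + t *\<^sub>R b) has_derivative (\<lambda>h. h *\<^sub>R b)) (at 0)"
        by (auto intro!: derivative_eq_intros)
      from has_derivative_compose[OF this, of W "W' x"] W[of x]
      have "((\<lambda>t. W (x + t *\<^sub>R b)) has_derivative (\<lambda>h. W' x (h *\<^sub>R b))) (at 0)"
        by simp
      then have "((\<lambda>t. W (x + t *\<^sub>R b) \<bullet> b) has_derivative (\<lambda>h. W' x (h *\<^sub>R b) \<bullet> b)) (at 0)"
        by (rule has_derivative_inner_left)
      also have "(\<lambda>h. W' x (h *\<^sub>R b) \<bullet> b) = (*) (W' x b \<bullet> b)"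
        by (auto simp: linear_scale[OF has_derivative_linear[OF W]])
      finally show ?thesis
        by (simp add: has_field_derivative_def)
    qed
    show ?thesis
      using integral_directional_derivative[OF cont supp(1) _ deriv L] supp(2) by auto
  qed
  then show "(LINT x|lborel. tr (W' x)) = 0" "integrable lborel (\<lambda>x. tr (W' x))"
    by (auto simp: tr_def)
qed

text \<open>A \<open>C\<^sup>1\<close> step from \<open>0\<close> to \<open>1\<close> on \<open>[0, 2]\<close> whose derivative is the hat function.\<close>

definition cutoff :: "real \<Rightarrow> real" where
  "cutoff t = ((max 0 t)\<^sup>2 - 2 * (max 0 (t - 1))\<^sup>2 + (max 0 (t - 2))\<^sup>2) / 2"

definition cutoff' :: "real \<Rightarrow> real" where
  "cutoff' t = max 0 t - 2 * max 0 (t - 1) + max 0 (t - 2)"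

lemma max0_square_deriv: "((\<lambda>t. (max 0 t)\<^sup>2) has_real_derivative 2 * max 0 t) (at t)"
proof (cases "t = 0")
  case True
  have "((\<lambda>h. (max 0 h)\<^sup>2 / h) \<longlongrightarrow> 0) (at (0::real))"
  proof (rule Lim_null_comparison)
    show "\<forall>\<^sub>F h in at 0. norm ((max 0 h)\<^sup>2 / h) \<le> \<bar>h::real\<bar>"
      by (intro always_eventually allI) (auto simp: max_def power2_eq_square)
    show "((\<lambda>h. \<bar>h::real\<bar>) \<longlongrightarrow> 0) (at 0)"
      by (auto intro!: tendsto_eq_intros)
  qed
  then show ?thesis
    using True by (simp add: DERIV_def)
next
  case False
  then consider "t > 0" | "t < 0"
    by linarith
  then show ?thesis
  proof cases
    case 1
    have "((\<lambda>t. t\<^sup>2) has_real_derivative 2 * max 0 t) (at t)"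
      using 1 by (auto intro!: derivative_eq_intros)
    then show ?thesis
      by (rule has_field_derivative_transform_within_open[of _ _ _ "{0<..}"]) (use 1 in auto)
  next
    case 2
    have "((\<lambda>t. 0) has_real_derivative 2 * max 0 t) (at t)"
      using 2 by (auto intro!: derivative_eq_intros)
    then show ?thesis
      by (rule has_field_derivative_transform_within_open[of _ _ _ "{..<0}"]) (use 2 in auto)
  qed
qed

lemma cutoff_deriv: "(cutoff has_real_derivative cutoff' t) (at t)"
proof -
  have "((\<lambda>s. (max 0 (s - c))\<^sup>2) has_real_derivative 2 * max 0 (t - c)) (at t)" for c
    using DERIV_shift[of "\<lambda>s. (max 0 s)\<^sup>2" "2 * max 0 (t - c)" t "- c"] max0_square_deriv[of "t - c"]
    by simp
  from DERIV_cdivide[OF DERIV_add[OF DERIV_diff[OF this[of 0] DERIV_cmult[OF this[of 1], of 2]] this[of 2]], of 2]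
  show ?thesis
    by (simp add: cutoff_def[abs_def] cutoff'_def diff_divide_distrib add_divide_distrib)
qed

lemma cutoff'_nonneg: "cutoff' t \<ge> 0"
  by (auto simp: cutoff'_def max_def)

lemma cutoff_eq_0: "t \<le> 0 \<Longrightarrow> cutoff t = 0"
  by (auto simp: cutoff_def max_def)

lemma cutoff'_eq_0: "t \<le> 0 \<or> t \<ge> 2 \<Longrightarrow> cutoff' t = 0"
  by (auto simp: cutoff'_def max_def)

lemma cutoff_eq_1: "t \<ge> 2 \<Longrightarrow> cutoff t = 1"
  by (auto simp: cutoff_def max_def power2_eq_square algebra_simps)

lemma cutoff_bounds: "0 \<le> cutoff t" "cutoff t \<le> 1"
proof -
  have mono: "cutoff a \<le> cutoff b" if "a \<le> b" for a b
    using DERIV_nonneg_imp_nondecreasing[OF that] cutoff_deriv cutoff'_nonneg by blast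
  show "0 \<le> cutoff t"
    using mono[of "min 0 t" t] cutoff_eq_0[of "min 0 t"] by simp
  show "cutoff t \<le> 1"
    using mono[of t "max 2 t"] cutoff_eq_1[of "max 2 t"] by simp
qed

section \<open>Divergence theorem on a domain described by a positive function\<close>

lemma compact_continuous_bounded:
  fixes g :: "'a::metric_space \<Rightarrow> 'b::real_normed_vector"
  assumes "compact S" "continuous_on S g"
  obtains M where "M > 0" "\<And>x. x \<in> S \<Longrightarrow> norm (g x) \<le> M"
  using compact_imp_bounded[OF compact_continuous_image[OF assms(2,1)]]
  unfolding bounded_pos by auto

lemma set_integrable_continuous_closure:
  fixes g :: "'a::euclidean_space \<Rightarrow> real"
  assumes "open S" "bounded S" "continuous_on (closure S) g"
  shows "set_integrable lborel S g"
proof (rule set_integrable_subset)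
  show "set_integrable lborel (closure S) g"
    unfolding set_integrable_def
    by (rule borel_integrable_compact) (use assms in \<open>auto simp: compact_closure\<close>)
qed (use assms(1) closure_subset in auto)

text \<open>Here \<open>u\<close> serves as a defining function of the domain: its small values
  single out a boundary layer, and its gradient replaces the normal.\<close>

locale positive_domain =
  fixes \<Omega> :: "'a::euclidean_space set" and u :: "'a \<Rightarrow> real" and Du :: "'a \<Rightarrow> 'a" and D2u :: "'a \<Rightarrow> 'a \<Rightarrow> 'a"
  assumes open_dom: "open \<Omega>" and bounded_dom: "bounded \<Omega>"
    and cont_u: "continuous_on (closure \<Omega>) u"
    and cont_Du: "continuous_on (closure \<Omega>) Du"
    and grad: "\<And>x. x \<in> \<Omega> \<Longrightarrow> GDERIV u x :> Du x"
    and hess: "\<And>x. x \<in> \<Omega> \<Longrightarrow> (Du has_derivative D2u x) (at x)"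
    and hess_bounded: "\<And>b. b \<in> Basis \<Longrightarrow> bounded ((\<lambda>x. D2u x b \<bullet> b) ` \<Omega>)"
    and pos: "\<And>x. x \<in> \<Omega> \<Longrightarrow> u x > 0"
    and zero: "\<And>x. x \<in> frontier \<Omega> \<Longrightarrow> u x = 0"
    and grad_nonzero: "\<And>x. x \<in> frontier \<Omega> \<Longrightarrow> Du x \<noteq> 0"
begin

lemma compact_dom: "compact (closure \<Omega>)"
  using bounded_dom by (simp add: compact_closure)

lemma closure_cases:
  assumes "x \<in> closure \<Omega>"
  obtains "x \<in> \<Omega>" | "x \<in> frontier \<Omega>" "x \<notin> \<Omega>"
  using assms open_dom by (auto simp: frontier_def interior_open)

text \<open>The factor \<^term>\<open>\<phi> (u x)\<close> makes the field vanish near the boundary, so no regularity of the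
  boundary is needed.\<close>

lemma integral_divergence_cutoff:
  assumes contZ: "continuous_on (closure \<Omega>) Z"
    and Z: "\<And>x. x \<in> \<Omega> \<Longrightarrow> (Z has_derivative Z' x) (at x)"
    and Z'_bounded: "\<And>b. b \<in> Basis \<Longrightarrow> bounded ((\<lambda>x. Z' x b \<bullet> b) ` \<Omega>)"
    and \<phi>: "\<And>s. (\<phi> has_real_derivative \<phi>' s) (at s)" "continuous_on UNIV \<phi>'"
    and \<phi>_0: "\<epsilon> > 0" "\<And>s. s \<le> \<epsilon> \<Longrightarrow> \<phi> s = 0"
  defines "f \<equiv> \<lambda>x. \<phi> (u x) * tr (Z' x) + \<phi>' (u x) * (Du x \<bullet> Z x)"
  shows "set_integrable lborel \<Omega> f" "(LINT x:\<Omega>|lborel. f x) = 0"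
proof -
  define W where "W x = (if x \<in> \<Omega> then \<phi> (u x) *\<^sub>R Z x else 0)" for x
  define W' where "W' x h = (if x \<in> \<Omega> then \<phi> (u x) *\<^sub>R Z' x h + (\<phi>' (u x) * (h \<bullet> Du x)) *\<^sub>R Z x else 0)" for x h
  \<comment> \<open>A closed set containing the support of \<open>W\<close>. As \<open>u\<close> is
    0 on the frontier and \<epsilon> > 0, it lies inside the domain, so the extension of
    \<open>W\<close> by 0 is differentiable everywhere.\<close>
  define K where "K = {x \<in> closure \<Omega>. u x \<in> {\<epsilon>..}}"
  have closed_K: "closed K"
    unfolding K_def by (rule continuous_closed_preimage[OF cont_u, unfolded vimage_def Int_def mem_Collect_eq]) auto
  have K_sub: "K \<subseteq> \<Omega>"
  proof
    fix x assume "x \<in> K"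
    then show "x \<in> \<Omega>"
      using zero[of x] \<phi>_0(1) by (auto simp: K_def elim: closure_cases)
  qed
  have W_0: "W x = 0" if "x \<notin> K" for x
    using that \<phi>_0(2)[of "u x"] closure_subset[of \<Omega>] by (auto simp: W_def K_def)
  have W: "(W has_derivative W' x) (at x)" for x
  proof (cases "x \<in> \<Omega>")
    case True
    have "((\<lambda>x. \<phi> (u x)) has_derivative (\<lambda>h. \<phi>' (u x) * (h \<bullet> Du x))) (at x)"
      using GDERIV_DERIV_compose[OF grad[OF True] \<phi>(1)[of "u x"]]
      by (simp add: gderiv_def)
    from has_derivative_scaleR[OF this Z[OF True]]
    have "((\<lambda>x. \<phi> (u x) *\<^sub>R Z x) has_derivative W' x) (at x)"
      using True by (simp add: W'_def[abs_def])
    then show ?thesis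
      by (rule has_derivative_transform_within_open[OF _ open_dom True]) (auto simp: W_def)
  next
    case False
    have "((\<lambda>x. 0) has_derivative W' x) (at x)"
      using False by (simp add: W'_def[abs_def])
    then show ?thesis
      by (rule has_derivative_transform_within_open[of _ _ _ _ "- K"]) (use False K_sub closed_K W_0 in auto)
  qed
  have W'_bounded: "bounded (range (\<lambda>x. W' x b \<bullet> b))" if b: "b \<in> Basis" for b
  proof -
    have c1: "continuous_on UNIV \<phi>"
      using \<phi>(1) by (intro continuous_at_imp_continuous_on ballI DERIV_isCont) auto
    obtain A where A: "A > 0" "\<And>x. x \<in> closure \<Omega> \<Longrightarrow> norm (\<phi> (u x)) \<le> A"
      using compact_continuous_bounded[OF compact_dom continuous_on_compose2[OF c1 cont_u]] by auto
    obtain B where B: "B > 0" "\<And>x. x \<in> closure \<Omega> \<Longrightarrow> norm (\<phi>' (u x) * (b \<bullet> Du x) * (Z x \<bullet> b)) \<le> B"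
    proof -
      have "continuous_on (closure \<Omega>) (\<lambda>x. \<phi>' (u x) * (b \<bullet> Du x) * (Z x \<bullet> b))"
        using continuous_on_compose2[OF \<phi>(2) cont_u] cont_Du contZ by (intro continuous_intros) auto
      then show thesis
        using that by (rule compact_continuous_bounded[OF compact_dom])
    qed
    obtain M where M: "M > 0" "\<And>x. x \<in> \<Omega> \<Longrightarrow> norm (Z' x b \<bullet> b) \<le> M"
      using Z'_bounded[OF b] unfolding bounded_pos by auto
    have "norm (W' x b \<bullet> b) \<le> A * M + B" for x
    proof (cases "x \<in> \<Omega>")
      case True
      then have x: "x \<in> closure \<Omega>"
        using closure_subset by auto
      have "norm (W' x b \<bullet> b) \<le> norm (\<phi> (u x) * (Z' x b \<bullet> b)) + norm (\<phi>' (u x) * (b \<bullet> Du x) * (Z x \<bullet> b))"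
        using True norm_triangle_ineq by (simp add: W'_def inner_add_left)
      also have "\<dots> \<le> A * M + B"
        using A B M x True unfolding norm_mult by (intro add_mono mult_mono) (auto simp: abs_mult)
      finally show ?thesis .
    qed (use A B M in \<open>auto simp: W'_def\<close>)
    then show ?thesis
      unfolding bounded_iff by blast
  qed
  have tr: "tr (W' x) = indicator \<Omega> x *\<^sub>R f x" for x
  proof (cases "x \<in> \<Omega>")
    case True
    have "tr (W' x) = (\<Sum>b\<in>Basis. \<phi> (u x) * (Z' x b \<bullet> b) + \<phi>' (u x) * ((Du x \<bullet> b) * (Z x \<bullet> b)))"
      unfolding tr_def W'_def using True by (simp add: inner_add_left inner_commute[of _ "Du x"] mult.assoc)
    also have "\<dots> = f x"
      by (simp add: f_def tr_def sum.distrib sum_distrib_left euclidean_inner[of "Du x" "Z x"])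
    finally show ?thesis
      using True by simp
  qed (simp add: tr_def W'_def)
  note * = integral_divergence_compact_support[OF W bounded_subset[OF bounded_dom K_sub] W_0 W'_bounded]
  show "set_integrable lborel \<Omega> f"
    using *(2) unfolding tr set_integrable_def .
  show "(LINT x:\<Omega>|lborel. f x) = 0"
    using *(1) unfolding tr set_lebesgue_integral_def .
qed

text \<open>The part of the closure where g is nonnegative is compact and avoids the frontier, so
  \<open>u\<close> has a positive minimum on it; this minimum serves as \<epsilon>.\<close>

lemma negative_near_frontier:
  assumes cont: "continuous_on (closure \<Omega>) (g :: 'a \<Rightarrow> real)"
    and neg: "\<And>x. x \<in> frontier \<Omega> \<Longrightarrow> g x < 0"
  obtains \<epsilon> where "\<epsilon> > 0" "\<And>x. x \<in> \<Omega> \<Longrightarrow> u x < \<epsilon> \<Longrightarrow> g x < 0"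
proof -
  define K where "K = closure \<Omega> \<inter> g -` {0..}"
  have "closed K"
    unfolding K_def by (rule continuous_closed_preimage[OF cont]) auto
  then have K: "compact K"
    unfolding K_def using compact_dom by (metis Int_assoc Int_absorb compact_Int_closed)
  show thesis
  proof (cases "K = {}")
    case True
    then show thesis
      using that[of 1] closure_subset[of \<Omega>] by (force simp: K_def)
  next
    case False
    obtain y where y: "y \<in> K" "\<And>x. x \<in> K \<Longrightarrow> u y \<le> u x"
      using continuous_attains_inf[OF K False continuous_on_subset[OF cont_u]] by (auto simp: K_def)
    have "y \<in> \<Omega>"
      using y(1) neg[of y] by (auto simp: K_def elim: closure_cases)
    then show thesis
      using that[of "u y"] pos[of y] y(2) closure_subset[of \<Omega>] by (force simp: K_def)
  qed
qed

text \<open>The boundary layer term \<open>\<integral> \<phi>' (u x) * (Du x \<bullet> Z x)\<close> is at most \<open>\<delta>\<close> times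
  \<open>\<integral> \<phi>' (u x) * (Du x \<bullet> Du x)\<close>, and the latter integral is bounded uniformly in the cutoff:
  apply the cutoff identity to the field \<open>Du\<close> itself.\<close>

theorem integral_divergence_tangential:
  assumes contZ: "continuous_on (closure \<Omega>) Z"
    and Z: "\<And>x. x \<in> \<Omega> \<Longrightarrow> (Z has_derivative Z' x) (at x)"
    and Z'_bounded: "\<And>b. b \<in> Basis \<Longrightarrow> bounded ((\<lambda>x. Z' x b \<bullet> b) ` \<Omega>)"
    and tangential: "\<And>x. x \<in> frontier \<Omega> \<Longrightarrow> Du x \<bullet> Z x = 0"
  shows "(LINT x:\<Omega>|lborel. tr (Z' x)) = 0"
proof -
  define N where "N n = real (Suc n)" for n
  \<comment> \<open>The cutoff vanishes for s \<le> 1/N and equals 1 for s \<ge> 3/N; this is where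
    the thresholds 3 / u x and 3 / \<epsilon> below come from.\<close>
  define \<phi> where "\<phi> n s = cutoff (N n * s - 1)" for n s
  define \<phi>' where "\<phi>' n s = N n * cutoff' (N n * s - 1)" for n s
  have N: "N n > 0" for n
    by (simp add: N_def)
  have \<phi>: "(\<phi> n has_real_derivative \<phi>' n s) (at s)" for n s
    unfolding \<phi>_def[abs_def] \<phi>'_def
    by (rule DERIV_cong[OF DERIV_chain2[OF cutoff_deriv]]) (auto intro!: derivative_eq_intros)
  have cont_\<phi>': "continuous_on UNIV (\<phi>' n)" for n
    unfolding \<phi>'_def[abs_def] cutoff'_def[abs_def] by (intro continuous_intros)
  have \<phi>_0: "\<phi> n s = 0" if "s \<le> 1 / N n" for n s
    using that N[of n] by (auto simp: \<phi>_def field_simps intro!: cutoff_eq_0)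
  have \<phi>'_nonneg: "\<phi>' n s \<ge> 0" for n s
    using N[of n] by (simp add: \<phi>'_def cutoff'_nonneg)
  have tr_bounded: "\<exists>M. M > 0 \<and> (\<forall>x\<in>\<Omega>. \<bar>tr (Y' x)\<bar> \<le> M)"
    if Y: "\<And>b. b \<in> Basis \<Longrightarrow> bounded ((\<lambda>x. Y' x b \<bullet> b) ` \<Omega>)" for Y' :: "'a \<Rightarrow> 'a \<Rightarrow> 'a"
  proof -
    have "\<exists>M. \<forall>x\<in>\<Omega>. \<bar>Y' x b \<bullet> b\<bar> \<le> M" if "b \<in> Basis" for b
      using Y[OF that] by (auto simp: bounded_iff)
    then obtain M where M: "\<And>b x. b \<in> Basis \<Longrightarrow> x \<in> \<Omega> \<Longrightarrow> \<bar>Y' x b \<bullet> b\<bar> \<le> M b"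
      by metis
    have "\<bar>tr (Y' x)\<bar> \<le> \<bar>sum M Basis\<bar> + 1" if "x \<in> \<Omega>" for x
    proof -
      have "(\<Sum>b\<in>Basis. \<bar>Y' x b \<bullet> b\<bar>) \<le> sum M Basis"
        using M that by (intro sum_mono) auto
      then show ?thesis
        using sum_abs[of "\<lambda>b. Y' x b \<bullet> b" Basis] unfolding tr_def by linarith
    qed
    then show ?thesis
      by (intro exI[of _ "\<bar>sum M Basis\<bar> + 1"]) auto
  qed
  have split: "set_integrable lborel \<Omega> (\<lambda>x. \<phi> n (u x) * tr (Y' x))"
      "(LINT x:\<Omega>|lborel. \<phi> n (u x) * tr (Y' x)) = - (LINT x:\<Omega>|lborel. \<phi>' n (u x) * (Du x \<bullet> Y x))"
      "set_integrable lborel \<Omega> (\<lambda>x. \<phi>' n (u x) * (Du x \<bullet> Y x))"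
    if Y: "continuous_on (closure \<Omega>) Y" "\<And>x. x \<in> \<Omega> \<Longrightarrow> (Y has_derivative Y' x) (at x)"
      "\<And>b. b \<in> Basis \<Longrightarrow> bounded ((\<lambda>x. Y' x b \<bullet> b) ` \<Omega>)" for Y Y' n
  proof -
    note * = integral_divergence_cutoff[OF Y \<phi> cont_\<phi>', of "1 / N n" n]
    have 1: "set_integrable lborel \<Omega> (\<lambda>x. \<phi> n (u x) * tr (Y' x) + \<phi>' n (u x) * (Du x \<bullet> Y x))"
      "(LINT x:\<Omega>|lborel. \<phi> n (u x) * tr (Y' x) + \<phi>' n (u x) * (Du x \<bullet> Y x)) = 0"
      using *[OF _ _ _ \<phi>_0] N[of n] by auto
    show 2: "set_integrable lborel \<Omega> (\<lambda>x. \<phi>' n (u x) * (Du x \<bullet> Y x))"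
      using continuous_on_compose2[OF cont_\<phi>' cont_u] cont_Du Y(1)
      by (intro set_integrable_continuous_closure open_dom bounded_dom continuous_intros) auto
    \<comment> \<open>The divergence of \<open>Y\<close> is only known to be bounded on the
      diagonal, not continuous; integrability is obtained by subtracting the continuous layer term
      from the integrable sum.\<close>
    show 3: "set_integrable lborel \<Omega> (\<lambda>x. \<phi> n (u x) * tr (Y' x))"
      using set_integral_diff(1)[OF 1(1) 2] by simp
    show "(LINT x:\<Omega>|lborel. \<phi> n (u x) * tr (Y' x)) = - (LINT x:\<Omega>|lborel. \<phi>' n (u x) * (Du x \<bullet> Y x))"
      using set_integral_add(2)[OF 3 2] 1(2) by simp
  qed
  note sZ = split[OF contZ Z Z'_bounded] and sD = split[OF cont_Du hess hess_bounded]
  obtain M where M: "M > 0" "\<And>x. x \<in> \<Omega> \<Longrightarrow> \<bar>tr (D2u x)\<bar> \<le> M"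
    using tr_bounded[OF hess_bounded] by blast
  obtain M' where M': "M' > 0" "\<And>x. x \<in> \<Omega> \<Longrightarrow> \<bar>tr (Z' x)\<bar> \<le> M'"
    using tr_bounded[OF Z'_bounded] by blast
  have fin: "emeasure lborel \<Omega> < \<infinity>"
    using bounded_dom by (rule emeasure_bounded_finite)
  have int_const: "set_integrable lborel \<Omega> (\<lambda>x. c)" for c :: real
    using open_dom bounded_dom by (intro set_integrable_continuous_closure) auto
  have lim: "(\<lambda>n. LINT x:\<Omega>|lborel. \<phi> n (u x) * tr (Z' x)) \<longlonglongrightarrow> (LINT x:\<Omega>|lborel. tr (Z' x))"
  proof -
    have ptw: "(\<lambda>n. indicator \<Omega> x *\<^sub>R (\<phi> n (u x) * tr (Z' x))) \<longlonglongrightarrow> indicator \<Omega> x *\<^sub>R tr (Z' x)" for x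
    proof (cases "x \<in> \<Omega>")
      case True
      obtain n0 where n0: "3 / u x < real n0"
        using reals_Archimedean2 by blast
      have "\<forall>\<^sub>F n in sequentially. \<phi> n (u x) = 1"
      proof (rule eventually_sequentiallyI)
        fix n assume "n \<ge> n0"
        then have "3 / u x \<le> N n"
          using n0 by (simp add: N_def)
        then show "\<phi> n (u x) = 1"
          using pos[OF True] unfolding \<phi>_def by (intro cutoff_eq_1) (simp add: field_simps)
      qed
      then show ?thesis
        by (intro tendsto_eventually) (auto elim: eventually_mono)
    qed simp
    have meas: "(\<lambda>x. indicator \<Omega> x *\<^sub>R (\<phi> n (u x) * tr (Z' x))) \<in> borel_measurable lborel" for n
      using sZ(1)[of n] by (auto simp: set_integrable_def)
    show ?thesis
      unfolding set_lebesgue_integral_def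
    proof (rule integral_dominated_convergence[where w = "\<lambda>x. indicator \<Omega> x *\<^sub>R M'"])
      show "(\<lambda>x. indicator \<Omega> x *\<^sub>R tr (Z' x)) \<in> borel_measurable lborel"
        by (rule borel_measurable_LIMSEQ_real[OF ptw meas])
      show "integrable lborel (\<lambda>x. indicator \<Omega> x *\<^sub>R M')"
        using int_const[of M'] by (simp add: set_integrable_def)
      show "AE x in lborel. norm (indicator \<Omega> x *\<^sub>R (\<phi> n (u x) * tr (Z' x))) \<le> indicator \<Omega> x *\<^sub>R M'" for n
      proof (rule AE_I2)
        fix x
        have "\<bar>\<phi> n (u x)\<bar> * \<bar>tr (Z' x)\<bar> \<le> 1 * M'" if "x \<in> \<Omega>"
          using cutoff_bounds[of "N n * u x - 1"] M'(2)[OF that] by (intro mult_mono) (auto simp: \<phi>_def)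
        then show "norm (indicator \<Omega> x *\<^sub>R (\<phi> n (u x) * tr (Z' x))) \<le> indicator \<Omega> x *\<^sub>R M'"
          by (auto simp: indicator_def abs_mult)
      qed
    qed (use ptw meas in auto)
  qed
  have "\<bar>LINT x:\<Omega>|lborel. tr (Z' x)\<bar> \<le> \<delta> * (M * measure lborel \<Omega>)" if "\<delta> > 0" for \<delta>
  proof -
    \<comment> \<open>On the frontier this function is -\<delta> |Du|^2 < 0 by tangency, so it stays
      negative in a layer u < \<epsilon>.\<close>
    have 1: "continuous_on (closure \<Omega>) (\<lambda>x. \<bar>Du x \<bullet> Z x\<bar> - \<delta> * (Du x \<bullet> Du x))"
      using cont_Du contZ by (intro continuous_intros)
    have 2: "\<bar>Du x \<bullet> Z x\<bar> - \<delta> * (Du x \<bullet> Du x) < 0" if "x \<in> frontier \<Omega>" for x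
      using tangential[OF that] grad_nonzero[OF that] \<open>\<delta> > 0\<close> by simp
    obtain \<epsilon> where \<epsilon>: "\<epsilon> > 0"
      "\<And>x. x \<in> \<Omega> \<Longrightarrow> u x < \<epsilon> \<Longrightarrow> \<bar>Du x \<bullet> Z x\<bar> - \<delta> * (Du x \<bullet> Du x) < 0"
      using negative_near_frontier[OF 1 2] by blast
    obtain n0 where n0: "3 / \<epsilon> < real n0"
      using reals_Archimedean2 by blast
    have "\<bar>LINT x:\<Omega>|lborel. \<phi> n (u x) * tr (Z' x)\<bar> \<le> \<delta> * (M * measure lborel \<Omega>)" if n: "n \<ge> n0" for n
    proof -
      have le: "\<bar>\<phi>' n (u x) * (Du x \<bullet> Z x)\<bar> \<le> \<delta> * (\<phi>' n (u x) * (Du x \<bullet> Du x))" if x: "x \<in> \<Omega>" for x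
      proof (cases "u x < \<epsilon>")
        case True
        then have "\<phi>' n (u x) * \<bar>Du x \<bullet> Z x\<bar> \<le> \<phi>' n (u x) * (\<delta> * (Du x \<bullet> Du x))"
          using \<epsilon>(2)[OF x] \<phi>'_nonneg by (intro mult_left_mono) auto
        then show ?thesis
          using \<phi>'_nonneg[of n "u x"] by (simp add: abs_mult mult_ac)
      next
        case False
        \<comment> \<open>Outside the layer the argument of \<open>cutoff'\<close> is at least 2, so
          the derivative of the cutoff vanishes.\<close>
        have "3 / \<epsilon> \<le> N n"
          using n0 n by (simp add: N_def)
        then have "3 \<le> N n * \<epsilon>"
          using \<epsilon>(1) by (simp add: field_simps)
        also have "\<dots> \<le> N n * u x"
          using False N[of n] by simp
        finally have "\<phi>' n (u x) = 0"
          by (simp add: \<phi>'_def cutoff'_eq_0)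
        then show ?thesis
          by simp
      qed
      have "\<bar>LINT x:\<Omega>|lborel. \<phi> n (u x) * tr (Z' x)\<bar> = \<bar>LINT x:\<Omega>|lborel. \<phi>' n (u x) * (Du x \<bullet> Z x)\<bar>"
        using sZ(2) by simp
      also have "\<dots> \<le> (LINT x:\<Omega>|lborel. \<bar>\<phi>' n (u x) * (Du x \<bullet> Z x)\<bar>)"
        using set_integral_norm_bound[OF sZ(3)[of n]] by simp
      also have "\<dots> \<le> (LINT x:\<Omega>|lborel. \<delta> * (\<phi>' n (u x) * (Du x \<bullet> Du x)))"
        using le sD(3)[of n] sZ(3)[of n]
        by (intro set_integral_mono set_integrable_abs set_integrable_mult_right) auto
      \<comment> \<open>The cutoff identity for the field \<open>Du\<close> trades the singular
        factor \<open>\<phi>' n\<close> for the bounded \<open>\<phi> n\<close>.\<close>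
      also have "\<dots> = \<delta> * (LINT x:\<Omega>|lborel. - (\<phi> n (u x) * tr (D2u x)))"
        using sD(2)[of n] by (simp add: set_lebesgue_integral_def)
      also have "\<dots> \<le> \<delta> * (LINT x:\<Omega>|lborel. M)"
      proof -
        have "- (\<phi> n (u x) * tr (D2u x)) \<le> M" if "x \<in> \<Omega>" for x
        proof -
          have "\<bar>\<phi> n (u x)\<bar> * \<bar>tr (D2u x)\<bar> \<le> 1 * M"
            using cutoff_bounds[of "N n * u x - 1"] M(2)[OF that] by (intro mult_mono) (auto simp: \<phi>_def)
          then show ?thesis
            by (simp add: abs_mult[symmetric])
        qed
        moreover have "set_integrable lborel \<Omega> (\<lambda>x. - (\<phi> n (u x) * tr (D2u x)))"
          using sD(1)[of n] by (simp add: set_integrable_def)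
        ultimately show ?thesis
          using \<open>\<delta> > 0\<close> int_const by (intro mult_left_mono set_integral_mono) auto
      qed
      also have "(LINT x:\<Omega>|lborel. M) = M * measure lborel \<Omega>"
        using open_dom fin by (simp add: set_lebesgue_integral_def)
      finally show ?thesis .
    qed
    then have "\<forall>\<^sub>F n in sequentially. \<bar>LINT x:\<Omega>|lborel. \<phi> n (u x) * tr (Z' x)\<bar> \<le> \<delta> * (M * measure lborel \<Omega>)"
      unfolding eventually_sequentially by blast
    then show ?thesis
      by (rule tendsto_upperbound[OF tendsto_rabs[OF lim]]) simp
  qed
  note bd = this
  have "\<bar>LINT x:\<Omega>|lborel. tr (Z' x)\<bar> \<le> e" if "e > 0" for e
  proof -
    \<comment> \<open>The added 1 makes the divisor positive even without knowing that the measure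
      is.\<close>
    define m where "m = M * measure lborel \<Omega> + 1"
    have m: "m > 0" "M * measure lborel \<Omega> \<le> m"
      using M(1) by (auto simp: m_def add_nonneg_pos)
    have "\<bar>LINT x:\<Omega>|lborel. tr (Z' x)\<bar> \<le> e / m * (M * measure lborel \<Omega>)"
      using that m by (intro bd) auto
    also have "\<dots> \<le> e / m * m"
      using that m by (intro mult_left_mono) auto
    finally show ?thesis
      using m by simp
  qed
  then have "\<bar>LINT x:\<Omega>|lborel. tr (Z' x)\<bar> \<le> 0"
    by (meson dense_ge)
  then show ?thesis
    by simp
qed

end

subsection \<open>Maximum principles\<close>

text \<open>At the maximum f' is 0; if l were positive, f' would be positive just to the right of 0
  and f would rise above its maximum.\<close>

lemma local_max_second_derivative_nonpos:
  fixes f f' :: "real \<Rightarrow> real"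
  assumes "d > 0"
    and f: "\<And>s. \<bar>s\<bar> < d \<Longrightarrow> (f has_real_derivative f' s) (at s)"
    and f': "(f' has_real_derivative l) (at 0)"
    and max: "\<And>s. \<bar>s\<bar> < d \<Longrightarrow> f s \<le> f 0"
  shows "l \<le> 0"
proof (rule ccontr)
  assume "\<not> l \<le> 0"
  then obtain e where e: "e > 0" "\<And>h. 0 < h \<Longrightarrow> h < e \<Longrightarrow> f' 0 < f' (0 + h)"
    using DERIV_pos_inc_right[OF f'] by auto
  have "f' 0 = 0"
    using DERIV_local_max[OF f[of 0] \<open>d > 0\<close>] max \<open>d > 0\<close> by auto
  define h where "h = min d e / 2"
  have h: "0 < h" "h < d" "h < e"
    using \<open>d > 0\<close> e(1) by (auto simp: h_def min_def)
  obtain z where z: "0 < z" "z < h" "f h - f 0 = (h - 0) * f' z"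
    using MVT2[of 0 h f f'] h f by force
  then have "f' z > 0"
    using e(2)[of z] h \<open>f' 0 = 0\<close> by auto
  then have "f h > f 0"
    using z h by (smt (verit) mult_pos_pos)
  then show False
    using max[of h] h by auto
qed

lemma interior_max_tr_nonpos:
  assumes "open S" "p \<in> S"
    and grad: "\<And>x. x \<in> S \<Longrightarrow> GDERIV v x :> G x"
    and hess: "(G has_derivative D) (at p)"
    and max: "\<And>x. x \<in> S \<Longrightarrow> v x \<le> v p"
  shows "tr D \<le> 0"
proof -
  obtain d where d: "d > 0" "ball p d \<subseteq> S"
    using assms(1,2) openE by blast
  have "D b \<bullet> b \<le> 0" if b: "b \<in> Basis" for b
  proof (rule local_max_second_derivative_nonpos[OF d(1)])
    have inS: "p + s *\<^sub>R b \<in> S" if "\<bar>s\<bar> < d" for s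
    proof -
      have "dist p (p + s *\<^sub>R b) < d"
        using that b by (simp add: dist_norm)
      then show ?thesis
        using d(2) by auto
    qed
    show "((\<lambda>s. v (p + s *\<^sub>R b)) has_real_derivative b \<bullet> G (p + s *\<^sub>R b)) (at s)" if "\<bar>s\<bar> < d" for s
      by (intro gderiv_along_line grad inS that)
    show "v (p + s *\<^sub>R b) \<le> v (p + 0 *\<^sub>R b)" if "\<bar>s\<bar> < d" for s
      using max[OF inS[OF that]] by simp
    have "((\<lambda>s. p + s *\<^sub>R b) has_derivative (\<lambda>h. h *\<^sub>R b)) (at 0)"
      by (auto intro!: derivative_eq_intros)
    from has_derivative_compose[OF this, of G D] hess
    have "((\<lambda>s. G (p + s *\<^sub>R b)) has_derivative (\<lambda>h. D (h *\<^sub>R b))) (at 0)"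
      by simp
    then have "((\<lambda>s. b \<bullet> G (p + s *\<^sub>R b)) has_derivative (\<lambda>h. b \<bullet> D (h *\<^sub>R b))) (at 0)"
      by (rule has_derivative_inner_right)
    also have "(\<lambda>h. b \<bullet> D (h *\<^sub>R b)) = (*) (D b \<bullet> b)"
      by (auto simp: linear_scale[OF has_derivative_linear[OF hess]] inner_commute)
    finally show "((\<lambda>s. b \<bullet> G (p + s *\<^sub>R b)) has_real_derivative D b \<bullet> b) (at 0)"
      by (simp add: has_field_derivative_def)
  qed
  then show ?thesis
    unfolding tr_def by (rule sum_nonpos)
qed

text \<open>A positive trace excludes interior maxima, so the maximum over the closure lies on the
  frontier. The inequality is strict because x itself is already exceeded at some interior
  point.\<close>

lemma strict_maximum_principle:
  fixes v :: "'a::euclidean_space \<Rightarrow> real"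
  assumes "open \<Omega>" "bounded \<Omega>" "continuous_on (closure \<Omega>) v"
    and grad: "\<And>x. x \<in> \<Omega> \<Longrightarrow> GDERIV v x :> G x"
    and hess: "\<And>x. x \<in> \<Omega> \<Longrightarrow> (G has_derivative D x) (at x)"
    and tr: "\<And>x. x \<in> \<Omega> \<Longrightarrow> tr (D x) > 0"
    and x: "x \<in> \<Omega>"
  obtains y where "y \<in> frontier \<Omega>" "v x < v y"
proof -
  have *: "x \<in> closure \<Omega>"
    using x closure_subset by auto
  obtain y where y: "y \<in> closure \<Omega>" "\<And>z. z \<in> closure \<Omega> \<Longrightarrow> v z \<le> v y"
    using continuous_attains_sup[OF _ _ assms(3)] assms(2) * by (metis compact_closure empty_iff)
  have no_max: "\<exists>w\<in>\<Omega>. v z < v w" if "z \<in> \<Omega>" for z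
  proof (rule ccontr)
    assume "\<not> (\<exists>w\<in>\<Omega>. v z < v w)"
    then have "tr (D z) \<le> 0"
      by (intro interior_max_tr_nonpos[OF assms(1) that grad hess[OF that]]) (auto simp: not_less)
    then show False
      using tr[OF that] by simp
  qed
  obtain w where w: "w \<in> \<Omega>" "v x < v w"
    using no_max[OF x] by blast
  have "v w \<le> v y"
    using y(2)[of w] w(1) closure_subset by blast
  moreover have "y \<notin> \<Omega>"
    using no_max[of y] y(2) closure_subset[of \<Omega>] by (meson not_less subsetD)
  ultimately show thesis
    using that[of y] y(1) w(2) assms(1) by (auto simp: frontier_def interior_open)
qed

text \<open>Completing the square at the maximum point \<open>z0\<close> writes the P-function as
  \<open>\<bar>G - G z0\<bar>\<^sup>2\<close> plus a harmonic function, which then also has its maximum at \<open>z0\<close>.\<close>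

lemma P_function_interior_max:
  fixes G :: "complex \<Rightarrow> complex" and v :: "complex \<Rightarrow> real"
  assumes U: "open U" "connected U" and G: "G holomorphic_on U"
    and v: "\<And>z. z \<in> U \<Longrightarrow> (v has_derivative (\<lambda>h. Re (G z * h))) (at z)"
    and z0: "z0 \<in> U"
    and max: "\<And>z. z \<in> U \<Longrightarrow> (cmod (G z))\<^sup>2 + c * (v z - Re (z * G z)) \<le> (cmod (G z0))\<^sup>2 + c * (v z0 - Re (z0 * G z0))"
  shows "G constant_on U"
proof -
  obtain r where r: "r > 0" "ball z0 r \<subseteq> U"
    using U(1) z0 openE by blast
  have GB: "G holomorphic_on ball z0 r"
    using G r(2) holomorphic_on_subset by blast
  \<comment> \<open>On a ball \<open>G\<close> has a primitive \<open>H\<close>, and v - Re H has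
    zero derivative; hence v is locally the real part of a holomorphic function.\<close>
  obtain H where H: "\<And>z. z \<in> ball z0 r \<Longrightarrow> (H has_field_derivative G z) (at z within ball z0 r)"
    using holomorphic_convex_primitive'[OF convex_ball open_ball GB] by blast
  have H': "(H has_field_derivative G z) (at z)" if "z \<in> ball z0 r" for z
    using H[OF that] unfolding at_within_open[OF that open_ball] .
  have "\<exists>a. \<forall>z\<in>ball z0 r. v z - Re (H z) = a"
  proof (rule has_derivative_zero_constant[OF convex_ball])
    fix z assume z: "z \<in> ball z0 r"
    have "((\<lambda>z. v z - Re (H z)) has_derivative (\<lambda>h. Re (G z * h) - Re (G z * h))) (at z)"
      using H'[OF z] v[of z] z r(2)
      by (intro has_derivative_diff has_derivative_Re) (auto simp: has_field_derivative_def)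
    then show "((\<lambda>z. v z - Re (H z)) has_derivative (\<lambda>h. 0)) (at z within ball z0 r)"
      by (simp add: has_derivative_at_withinI)
  qed
  then obtain a where "\<And>z. z \<in> ball z0 r \<Longrightarrow> v z - Re (H z) = a"
    by blast
  then have a: "v z = Re (H z) + a" if "z \<in> ball z0 r" for z
    using that by (simp add: algebra_simps)
  \<comment> \<open>From |G|^2 = |G - G z0|^2 + 2 Re (cnj (G z0) G) - |G z0|^2; the remaining terms
    of the P-function are also real parts of holomorphic functions.\<close>
  define M where "M z = 2 * cnj (G z0) * G z - of_real ((cmod (G z0))\<^sup>2) + of_real c * (H z + of_real a - z * G z)" for z
  have M: "M holomorphic_on ball z0 r"
  proof -
    have "H holomorphic_on ball z0 r"
      using H' unfolding holomorphic_on_open[OF open_ball] by blast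
    then show ?thesis
      using GB unfolding M_def by (intro holomorphic_intros)
  qed
  have P: "(cmod (G z))\<^sup>2 + c * (v z - Re (z * G z)) = (cmod (G z - G z0))\<^sup>2 + Re (M z)" if "z \<in> ball z0 r" for z
    unfolding M_def a[OF that] cmod_power2 by (simp add: power2_eq_square algebra_simps)
  have z0': "z0 \<in> ball z0 r"
    using r by simp
  have le: "(cmod (G z - G z0))\<^sup>2 + Re (M z) \<le> Re (M z0)" if "z \<in> ball z0 r" for z
    using max[of z] P[OF that] P[OF z0'] that r(2) by auto
  have le': "Re (M z) \<le> Re (M z0)" if "z \<in> ball z0 r" for z
    using le[OF that] zero_le_power2[of "cmod (G z - G z0)"] by linarith
  \<comment> \<open>The modulus of exp M is exp (Re M), so the maximum modulus principle makes Re M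
    constant. The inequality \<open>le\<close> then leaves no room for |G - G z0|^2.\<close>
  have "(\<lambda>z. exp (M z)) constant_on ball z0 r"
    by (rule maximum_modulus_principle[of _ _ "ball z0 r" z0])
      (use M z0' le' in \<open>auto intro!: holomorphic_intros\<close>)
  then obtain K where "\<And>z. z \<in> ball z0 r \<Longrightarrow> exp (M z) = K"
    unfolding constant_on_def by blast
  then have "exp (M z) = exp (M z0)" if "z \<in> ball z0 r" for z
    using that z0' by simp
  then have "Re (M z) = Re (M z0)" if "z \<in> ball z0 r" for z
  proof -
    have "exp (Re (M z)) = exp (Re (M z0))"
      using \<open>\<And>z. z \<in> ball z0 r \<Longrightarrow> exp (M z) = exp (M z0)\<close>[OF that]
      by (simp flip: norm_exp_eq_Re)
    then show ?thesis
      by simp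
  qed
  then have "G z = G z0" if "z \<in> ball z0 r" for z
    using le[OF that] that by simp
  then have "G constant_on ball z0 r"
    unfolding constant_on_def by blast
  then show ?thesis
    using analytic_continuation'[OF G U r(2) z0] r(1) by (simp add: islimpt_ball)
qed

section \<open>Rules for computing divergences\<close>

lemma tr_matrix: "tr ((*v) (M :: real^'n^'n)) = trace M"
proof -
  have "tr ((*v) M) = (\<Sum>i\<in>UNIV. (M *v axis i 1) \<bullet> axis i 1)"
    unfolding tr_def Basis_vec_def
    by (simp add: sum.reindex inj_on_def axis_eq_axis UNION_singleton_eq_range)
  then show ?thesis
    by (simp add: trace_def inner_axis matrix_vector_mult_basis column_def)
qed

lemma tr_scaleR: "tr (\<lambda>h. c *\<^sub>R D h) = c * tr D"
  by (simp add: tr_def sum_distrib_left)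

lemma tr_add: "tr (\<lambda>h. D h + E h) = tr D + tr E"
  by (simp add: tr_def inner_add_left sum.distrib)

lemma tr_rank_one: "tr (\<lambda>h. (a \<bullet> h) *\<^sub>R w) = a \<bullet> w"
  by (simp add: tr_def euclidean_inner[of a w] inner_commute)

lemma tr_id: "tr (\<lambda>h::'a::euclidean_space. h) = DIM('a)"
  by (simp add: tr_def)

subsection \<open>Serrin's overdetermined problem in the plane\<close>

locale serrin_domain =
  fixes \<Omega> :: "(real^2) set" and u :: "real^2 \<Rightarrow> real" and Du :: "real^2 \<Rightarrow> real^2"
    and D2u :: "real^2 \<Rightarrow> real^2^2" and lam :: real
  assumes open_dom: "open \<Omega>" and bounded_dom: "bounded \<Omega>" and connected_dom: "connected \<Omega>"
    and nonempty: "\<Omega> \<noteq> {}"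
    and C2: "C2_closure \<Omega> u Du D2u"
    and laplacian: "\<And>x. x \<in> \<Omega> \<Longrightarrow> trace (D2u x) = - lam"
    and lam_pos: "lam > 0"
    and boundary_u: "\<And>x. x \<in> frontier \<Omega> \<Longrightarrow> u x = 0"
    and boundary_Du: "\<And>x. x \<in> frontier \<Omega> \<Longrightarrow> norm (Du x) = 1"
begin

lemma cont_u: "continuous_on (closure \<Omega>) u"
  and cont_Du: "continuous_on (closure \<Omega>) Du"
  and cont_D2u: "continuous_on (closure \<Omega>) D2u"
  and grad: "x \<in> \<Omega> \<Longrightarrow> GDERIV u x :> Du x"
  and hess: "x \<in> \<Omega> \<Longrightarrow> (Du has_derivative (*v) (D2u x)) (at x)"
  using C2 by (auto simp: C2_closure_def)

lemma cont_D2u_mult: "continuous_on (closure \<Omega>) (\<lambda>x. D2u x *v h)"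
  unfolding matrix_vector_mult_def
  by (intro continuous_intros cont_D2u)

text \<open>The function -u has Laplacian lam > 0, so it lies strictly below some boundary value,
  which is 0.\<close>

lemma u_pos:
  assumes "x \<in> \<Omega>"
  shows "u x > 0"
proof -
  have "\<exists>y\<in>frontier \<Omega>. - u x < - u y"
  proof (rule strict_maximum_principle[of \<Omega> "\<lambda>x. - u x" "\<lambda>x. - Du x" "\<lambda>x h. - (D2u x *v h)" x])
    show "GDERIV (\<lambda>x. - u x) x :> - Du x" if "x \<in> \<Omega>" for x
      using has_derivative_minus[OF grad[OF that, unfolded gderiv_def]] by (simp add: gderiv_def)
    show "((\<lambda>x. - Du x) has_derivative (\<lambda>h. - (D2u x *v h))) (at x)" if "x \<in> \<Omega>" for x
      using hess[OF that] by (rule has_derivative_minus)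
    show "tr (\<lambda>h. - (D2u x *v h)) > 0" if "x \<in> \<Omega>" for x
      using tr_scaleR[of "-1" "(*v) (D2u x)"] laplacian[OF that] lam_pos by (simp add: tr_matrix)
  qed (use assms open_dom bounded_dom cont_u in \<open>auto intro!: continuous_intros\<close>)
  then show ?thesis
    using boundary_u by force
qed

lemma closure_continuous_bounded:
  assumes "continuous_on (closure \<Omega>) (g :: real^2 \<Rightarrow> real)"
  shows "bounded (g ` \<Omega>)"
proof -
  have "compact (closure \<Omega>)"
    using bounded_dom by (simp add: compact_closure)
  from compact_imp_bounded[OF compact_continuous_image[OF assms this]]
  show ?thesis
    by (rule bounded_subset) (use closure_subset in blast)
qed

sublocale positive_domain \<Omega> u Du "\<lambda>x h. D2u x *v h"
proof
  show "Du x \<noteq> 0" if "x \<in> frontier \<Omega>" for x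
    using boundary_Du[OF that] by auto
  show "bounded ((\<lambda>x. (D2u x *v b) \<bullet> b) ` \<Omega>)" for b
    by (intro closure_continuous_bounded continuous_intros cont_D2u_mult)
qed (use open_dom bounded_dom cont_u cont_Du grad hess u_pos boundary_u in auto)

lemma hess_symmetric: "x \<in> \<Omega> \<Longrightarrow> v \<bullet> (D2u x *v w) = w \<bullet> (D2u x *v v)"
  using second_derivative_symmetric[OF open_dom _ grad hess] by blast

lemma tr_hess: "x \<in> \<Omega> \<Longrightarrow> tr ((*v) (D2u x)) = - lam"
  by (simp add: tr_matrix laplacian)

lemma grad': "x \<in> \<Omega> \<Longrightarrow> (u has_derivative (\<lambda>h. h \<bullet> Du x)) (at x)"
  using grad by (simp add: gderiv_def)

lemma boundary_Du_inner: "x \<in> frontier \<Omega> \<Longrightarrow> Du x \<bullet> Du x = 1"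
  using boundary_Du by (simp add: dot_square_norm)

section \<open>The energy and Pohozaev identities and the P-function\<close>

text \<open>The field u Du vanishes on the frontier and has divergence |Du|^2 + u \<Delta>u with
  \<Delta>u = -lam.\<close>

lemma energy_identity: "(LINT x:\<Omega>|lborel. Du x \<bullet> Du x - lam * u x) = 0"
proof -
  define Z' where "Z' x h = u x *\<^sub>R (D2u x *v h) + (Du x \<bullet> h) *\<^sub>R Du x" for x h
  have "(LINT x:\<Omega>|lborel. tr (Z' x)) = 0"
  proof (rule integral_divergence_tangential)
    show "continuous_on (closure \<Omega>) (\<lambda>x. u x *\<^sub>R Du x)"
      by (intro continuous_intros cont_u cont_Du)
    show "((\<lambda>x. u x *\<^sub>R Du x) has_derivative Z' x) (at x)" if "x \<in> \<Omega>" for x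
      using has_derivative_scaleR[OF grad'[OF that] hess[OF that]]
      by (simp add: Z'_def[abs_def] inner_commute)
    show "bounded ((\<lambda>x. Z' x b \<bullet> b) ` \<Omega>)" for b
      unfolding Z'_def by (intro closure_continuous_bounded continuous_intros cont_D2u_mult cont_u cont_Du)
  qed (simp add: boundary_u)
  also have "(LINT x:\<Omega>|lborel. tr (Z' x)) = (LINT x:\<Omega>|lborel. Du x \<bullet> Du x - lam * u x)"
  proof (intro set_lebesgue_integral_cong allI impI)
    show "tr (Z' x) = Du x \<bullet> Du x - lam * u x" if "x \<in> \<Omega>" for x
      unfolding Z'_def tr_add tr_scaleR tr_rank_one tr_hess[OF that] by simp
  qed (use open_dom in auto)
  finally show ?thesis .
qed

text \<open>On the frontier u = 0 and |Du| = 1, so Du \<bullet> Z is (x \<bullet> Du)(1 - 1/2 - 1/2)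
  = 0; this fixes the constant 1/2 in the field. In its divergence the two Hessian terms cancel by
  symmetry, and dimension 2 cancels the |Du|^2 terms.\<close>

lemma pohozaev_identity: "(LINT x:\<Omega>|lborel. 2 * lam * u x - 1) = 0"
proof -
  define Z where "Z x = (x \<bullet> Du x) *\<^sub>R Du x + (lam * u x - 1 / 2 * (Du x \<bullet> Du x) - 1 / 2) *\<^sub>R x" for x
  define Z' where "Z' x h = (x \<bullet> Du x) *\<^sub>R (D2u x *v h) + (Du x \<bullet> h) *\<^sub>R Du x + ((D2u x *v x) \<bullet> h) *\<^sub>R Du x +
      (lam * u x - 1 / 2 * (Du x \<bullet> Du x) - 1 / 2) *\<^sub>R h + ((lam *\<^sub>R Du x - D2u x *v Du x) \<bullet> h) *\<^sub>R x" for x h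
  have "(LINT x:\<Omega>|lborel. tr (Z' x)) = 0"
  proof (rule integral_divergence_tangential)
    show "continuous_on (closure \<Omega>) Z"
      unfolding Z_def by (intro continuous_intros cont_u cont_Du) auto
    show "(Z has_derivative Z' x) (at x)" if x: "x \<in> \<Omega>" for x
    proof -
      have "(Z has_derivative (\<lambda>h. (x \<bullet> Du x) *\<^sub>R (D2u x *v h) + (x \<bullet> (D2u x *v h) + h \<bullet> Du x) *\<^sub>R Du x +
          ((lam * u x - 1 / 2 * (Du x \<bullet> Du x) - 1 / 2) *\<^sub>R h +
            (lam * (h \<bullet> Du x) - 1 / 2 * (Du x \<bullet> (D2u x *v h) + (D2u x *v h) \<bullet> Du x) - 0) *\<^sub>R x))) (at x)"
        unfolding Z_def[abs_def] using hess[OF x] grad'[OF x]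
        by (intro has_derivative_add has_derivative_scaleR has_derivative_inner has_derivative_diff
          has_derivative_mult_right has_derivative_ident has_derivative_const)
      also have "(\<lambda>h. (x \<bullet> Du x) *\<^sub>R (D2u x *v h) + (x \<bullet> (D2u x *v h) + h \<bullet> Du x) *\<^sub>R Du x +
          ((lam * u x - 1 / 2 * (Du x \<bullet> Du x) - 1 / 2) *\<^sub>R h +
            (lam * (h \<bullet> Du x) - 1 / 2 * (Du x \<bullet> (D2u x *v h) + (D2u x *v h) \<bullet> Du x) - 0) *\<^sub>R x)) = Z' x"
      proof
        fix h
        have "x \<bullet> (D2u x *v h) = (D2u x *v x) \<bullet> h" "Du x \<bullet> (D2u x *v h) = (D2u x *v Du x) \<bullet> h"
          "(D2u x *v h) \<bullet> Du x = (D2u x *v Du x) \<bullet> h" "h \<bullet> Du x = Du x \<bullet> h"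
          using hess_symmetric[OF x, of h] by (simp_all add: inner_commute)
        then show "(x \<bullet> Du x) *\<^sub>R (D2u x *v h) + (x \<bullet> (D2u x *v h) + h \<bullet> Du x) *\<^sub>R Du x +
          ((lam * u x - 1 / 2 * (Du x \<bullet> Du x) - 1 / 2) *\<^sub>R h +
            (lam * (h \<bullet> Du x) - 1 / 2 * (Du x \<bullet> (D2u x *v h) + (D2u x *v h) \<bullet> Du x) - 0) *\<^sub>R x) = Z' x h"
          by (simp add: Z'_def scaleR_left_distrib inner_diff_left)
      qed
      finally show ?thesis .
    qed
    show "bounded ((\<lambda>x. Z' x b \<bullet> b) ` \<Omega>)" for b
    proof -
      have "continuous_on (closure \<Omega>) (\<lambda>x. D2u x *v Du x)" "continuous_on (closure \<Omega>) (\<lambda>x. D2u x *v x)"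
        unfolding matrix_vector_mult_def by (intro continuous_intros cont_D2u cont_Du)+
      then show ?thesis
        unfolding Z'_def
        by (intro closure_continuous_bounded continuous_intros cont_D2u_mult cont_u cont_Du) auto
    qed
    show "Du x \<bullet> Z x = 0" if "x \<in> frontier \<Omega>" for x
      using boundary_Du_inner[OF that] boundary_u[OF that]
      by (simp add: Z_def inner_add_right inner_diff_right inner_commute)
  qed
  also have "(LINT x:\<Omega>|lborel. tr (Z' x)) = (LINT x:\<Omega>|lborel. 2 * lam * u x - 1)"
  proof (intro set_lebesgue_integral_cong allI impI)
    fix x assume x: "x \<in> \<Omega>"
    have "tr (Z' x) = (x \<bullet> Du x) * (- lam) + Du x \<bullet> Du x + (D2u x *v x) \<bullet> Du x
        + (lam * u x - 1 / 2 * (Du x \<bullet> Du x) - 1 / 2) * 2 + (lam *\<^sub>R Du x - D2u x *v Du x) \<bullet> x"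
      unfolding Z'_def tr_add tr_scaleR tr_rank_one tr_hess[OF x] tr_id by simp
    then show "tr (Z' x) = 2 * lam * u x - 1"
      using hess_symmetric[OF x, of x "Du x"] by (simp add: inner_diff_left inner_commute algebra_simps)
  qed (use open_dom in auto)
  finally show ?thesis .
qed

lemma P_function_max_interior:
  "\<exists>y\<in>\<Omega>. \<forall>x\<in>\<Omega>. Du x \<bullet> Du x + lam * u x \<le> Du y \<bullet> Du y + lam * u y"
proof (rule ccontr)
  define P where "P x = Du x \<bullet> Du x + lam * u x" for x
  assume "\<not> (\<exists>y\<in>\<Omega>. \<forall>x\<in>\<Omega>. Du x \<bullet> Du x + lam * u x \<le> Du y \<bullet> Du y + lam * u y)"
  then have no_max: "\<exists>z\<in>\<Omega>. P y < P z" if "y \<in> \<Omega>" for y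
    using that by (force simp: P_def not_le)
  have cont_P: "continuous_on (closure \<Omega>) P"
    unfolding P_def by (intro continuous_intros cont_u cont_Du)
  have sub: "\<Omega> \<subseteq> closure \<Omega>"
    by (rule closure_subset)
  have "closure \<Omega> \<noteq> {}"
    using nonempty by simp
  then obtain y where y: "y \<in> closure \<Omega>" "\<And>x. x \<in> closure \<Omega> \<Longrightarrow> P x \<le> P y"
    using continuous_attains_sup[OF compact_dom _ cont_P] by blast
  have "y \<notin> \<Omega>"
    using no_max[of y] y(2) sub by (meson not_less subsetD)
  then have "y \<in> frontier \<Omega>"
    using y(1) closure_cases by blast
  then have "P y = 1"
    by (simp add: P_def boundary_Du_inner boundary_u)
  \<comment> \<open>Every interior value is exceeded by another interior value, so none reaches the
    maximum 1.\<close>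
  have P_less: "P x < 1" if x: "x \<in> \<Omega>" for x
  proof -
    obtain z where "z \<in> \<Omega>" "P x < P z"
      using no_max[OF x] by blast
    then show ?thesis
      using y(2)[of z] sub \<open>P y = 1\<close> by auto
  qed
  have int: "set_integrable lborel \<Omega> (\<lambda>x. Du x \<bullet> Du x - lam * u x)"
    "set_integrable lborel \<Omega> (\<lambda>x. 2 * lam * u x - 1)"
    by (intro set_integrable_continuous_closure open_dom bounded_dom continuous_intros cont_u cont_Du)+
  \<comment> \<open>The energy and Pohozaev integrands add up to P - 1. A negative function with
    integral 0 would force the nonempty open domain to be a null set.\<close>
  have "(\<lambda>x. Du x \<bullet> Du x - lam * u x + (2 * lam * u x - 1)) = (\<lambda>x. P x - 1)"
    by (simp add: P_def fun_eq_iff)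
  then have P_int: "set_integrable lborel \<Omega> (\<lambda>x. P x - 1)" "(LINT x:\<Omega>|lborel. P x - 1) = 0"
    using set_integral_add[OF int] energy_identity pohozaev_identity by simp_all
  then have "integrable lborel (\<lambda>x. indicator \<Omega> x * (1 - P x))" "(LINT x|lborel. indicator \<Omega> x * (1 - P x)) = 0"
    using integrable_minus[of lborel "\<lambda>x. indicator \<Omega> x * (P x - 1)"]
      Bochner_Integration.integral_minus[of lborel "\<lambda>x. indicator \<Omega> x * (P x - 1)"]
    by (auto simp: set_integrable_def set_lebesgue_integral_def algebra_simps)
  moreover have "AE x in lborel. 0 \<le> indicator \<Omega> x * (1 - P x)"
    using P_less by (auto simp: indicator_def intro!: AE_I2 less_imp_le)
  ultimately have "AE x in lborel. indicator \<Omega> x * (1 - P x) = 0"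
    using integral_nonneg_eq_0_iff_AE by blast
  then have "AE x in lborel. x \<notin> \<Omega>"
    by (rule AE_mp) (use P_less in \<open>force intro!: AE_I2 simp: indicator_def\<close>)
  then have "\<Omega> \<in> null_sets lborel"
    using open_dom by (simp add: AE_iff_null_sets)
  then have "negligible \<Omega>"
    by (simp add: negligible_iff_null_sets null_sets_completionI)
  then show False
    using open_not_negligible[OF open_dom nonempty] by simp
qed

text \<open>The maps \<open>\<kappa>\<close> and \<open>\<iota>\<close> identify the plane with the
  complex numbers, so that the interior maximum of the P-function makes the holomorphic
  \<open>G\<close> constant; its constancy says that Du + (lam/2) x is constant.\<close>

lemma gradient_affine: "\<exists>c. \<forall>x\<in>\<Omega>. Du x = - (lam / 2) *\<^sub>R (x - c)"
proof -
  define \<kappa> :: "real^2 \<Rightarrow> complex" where "\<kappa> x = Complex (x $ 1) (x $ 2)" for x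
  define \<iota> :: "complex \<Rightarrow> real^2" where "\<iota> z = Re z *\<^sub>R axis 1 1 + Im z *\<^sub>R axis 2 1" for z
  have \<iota>_nth: "\<iota> z $ 1 = Re z" "\<iota> z $ 2 = Im z" for z
    by (auto simp: \<iota>_def axis_def)
  have \<iota>\<kappa>: "\<iota> (\<kappa> x) = x" for x
    by (auto simp: vec_eq_iff forall_2 \<iota>_nth \<kappa>_def)
  have \<kappa>\<iota>: "\<kappa> (\<iota> z) = z" for z
    by (simp add: \<kappa>_def \<iota>_nth)
  have lin_\<iota>: "bounded_linear \<iota>"
    unfolding \<iota>_def
    by (intro bounded_linear_add bounded_linear_scaleR_const bounded_linear_Re bounded_linear_Im)
  have lin_\<kappa>: "bounded_linear \<kappa>"
  proof -
    have "\<kappa> = (\<lambda>x. of_real (x $ 1) + \<i> * of_real (x $ 2))"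
      by (auto simp: \<kappa>_def complex_eq_iff)
    then show ?thesis
      by (auto intro!: bounded_linear_add bounded_linear_compose[OF bounded_linear_mult_right]
        bounded_linear_compose[OF bounded_linear_of_real bounded_linear_vec_nth])
  qed
  have \<kappa>_inner: "x \<bullet> y = Re (cnj (\<kappa> x) * \<kappa> y)" for x y
    by (simp add: \<kappa>_def inner_vec_def sum_2)
  define U where "U = \<iota> -` \<Omega>"
  have "U = \<kappa> ` \<Omega>"
    unfolding U_def using \<iota>\<kappa> \<kappa>\<iota> by (auto simp: image_iff) (metis \<kappa>\<iota>)
  then have conn_U: "connected U"
    using connected_continuous_image[OF linear_continuous_on[OF lin_\<kappa>] connected_dom] by simp
  have open_U: "open U"
    unfolding U_def using open_dom linear_continuous_on[OF lin_\<iota>] by (rule open_vimage)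
  define G where "G z = cnj (\<kappa> (Du (\<iota> z))) + of_real (lam / 2) * cnj z" for z
  \<comment> \<open>The added quadratic cancels the Laplacian -lam, so v is harmonic;
    \<open>G\<close> is the conjugate of its gradient.\<close>
  define v where "v z = u (\<iota> z) + lam / 4 * (z \<bullet> z)" for z
  have \<iota>_deriv: "(\<iota> has_derivative \<iota>) (at z)" for z
    using bounded_linear_imp_has_derivative[OF lin_\<iota>] .
  \<comment> \<open>The Cauchy-Riemann equations for \<open>G\<close>: the Hessian of v is symmetric
    (\<open>M12\<close>) and has trace 0 (\<open>M22\<close>).\<close>
  have "(G has_field_derivative Complex (D2u (\<iota> z) $ 1 $ 1 + lam / 2) (- D2u (\<iota> z) $ 1 $ 2)) (at z)" if "z \<in> U" for z
  proof -
    have x: "\<iota> z \<in> \<Omega>"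
      using that by (simp add: U_def)
    define M where "M = D2u (\<iota> z)"
    have M12: "M $ 1 $ 2 = M $ 2 $ 1"
      using hess_symmetric[OF x, of "axis 1 1" "axis 2 1"]
      by (simp add: M_def inner_axis' matrix_vector_mult_basis column_def)
    have M22: "M $ 2 $ 2 = - lam - M $ 1 $ 1"
      using laplacian[OF x] by (simp add: M_def trace_def sum_2)
    have eq: "cnj (\<kappa> (M *v \<iota> h)) + of_real (lam / 2) * cnj h
        = Complex (M $ 1 $ 1 + lam / 2) (- M $ 1 $ 2) * h" for h
      by (simp add: complex_eq_iff \<kappa>_def matrix_vector_mult_def sum_2 \<iota>_nth M12 M22 algebra_simps)
    have "((\<lambda>z. Du (\<iota> z)) has_derivative (\<lambda>h. M *v \<iota> h)) (at z)"
      using has_derivative_compose[OF \<iota>_deriv hess[OF x]] by (simp add: M_def)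
    then have "((\<lambda>z. cnj (\<kappa> (Du (\<iota> z)))) has_derivative (\<lambda>h. cnj (\<kappa> (M *v \<iota> h)))) (at z)"
      by (intro bounded_linear.has_derivative[OF bounded_linear_cnj] bounded_linear.has_derivative[OF lin_\<kappa>])
    then have "(G has_derivative (\<lambda>h. cnj (\<kappa> (M *v \<iota> h)) + of_real (lam / 2) * cnj h)) (at z)"
      unfolding G_def[abs_def]
      by (intro has_derivative_add has_derivative_mult_right
        bounded_linear_imp_has_derivative[OF bounded_linear_cnj])
    then show ?thesis
      unfolding eq unfolding has_field_derivative_def M_def .
  qed
  then have G: "G holomorphic_on U"
    unfolding holomorphic_on_open[OF open_U] by blast
  have v: "(v has_derivative (\<lambda>h. Re (G z * h))) (at z)" if "z \<in> U" for z
  proof -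
    have x: "\<iota> z \<in> \<Omega>"
      using that by (simp add: U_def)
    have "(v has_derivative (\<lambda>h. \<iota> h \<bullet> Du (\<iota> z) + lam / 4 * (z \<bullet> h + h \<bullet> z))) (at z)"
      unfolding v_def[abs_def]
      by (intro has_derivative_add has_derivative_mult_right has_derivative_inner has_derivative_ident
        has_derivative_compose[OF \<iota>_deriv grad'[OF x]])
    also have "(\<lambda>h. \<iota> h \<bullet> Du (\<iota> z) + lam / 4 * (z \<bullet> h + h \<bullet> z)) = (\<lambda>h. Re (G z * h))"
      by (auto simp: G_def fun_eq_iff \<kappa>_inner \<kappa>\<iota> inner_complex_def algebra_simps)
    finally show ?thesis .
  qed
  have P: "(cmod (G z))\<^sup>2 + lam * (v z - Re (z * G z)) = Du (\<iota> z) \<bullet> Du (\<iota> z) + lam * u (\<iota> z)" for z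
    unfolding cmod_power2 G_def v_def \<kappa>_inner inner_complex_def
    by (simp add: power2_eq_square algebra_simps add_divide_distrib)
  obtain y where y: "y \<in> \<Omega>" "\<And>x. x \<in> \<Omega> \<Longrightarrow> Du x \<bullet> Du x + lam * u x \<le> Du y \<bullet> Du y + lam * u y"
    using P_function_max_interior by blast
  have "G constant_on U"
  proof (rule P_function_interior_max[OF open_U conn_U G v, of "\<kappa> y" lam])
    show "\<kappa> y \<in> U"
      using y(1) by (simp add: U_def \<iota>\<kappa>)
  qed (unfold P, use y(2) in \<open>auto simp: U_def \<iota>\<kappa>\<close>)
  then obtain g where g: "\<And>z. z \<in> U \<Longrightarrow> G z = g"
    unfolding constant_on_def by blast
  \<comment> \<open>The center solves Du + (lam/2) x = cnj g for the zero of the gradient.\<close>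
  have "Du x = - (lam / 2) *\<^sub>R (x - \<iota> (of_real (2 / lam) * cnj g))" if "x \<in> \<Omega>" for x
  proof -
    have "G (\<kappa> x) = g"
      using that by (intro g) (simp add: U_def \<iota>\<kappa>)
    then have "\<kappa> (Du x) = cnj g - of_real (lam / 2) * \<kappa> x"
      by (auto simp: G_def \<iota>\<kappa> complex_eq_iff)
    then show ?thesis
      using lam_pos by (simp add: vec_eq_iff forall_2 \<iota>_nth \<kappa>_def complex_eq_iff field_simps)
  qed
  then show ?thesis
    by blast
qed

section \<open>The domain is a disc\<close>

theorem serrin:
  "\<exists>c. \<Omega> = ball c (2 / lam) \<and> (\<forall>x\<in>closure \<Omega>. u x = lam / 4 * ((2 / lam)\<^sup>2 - (dist c x)\<^sup>2))"
proof -
  obtain c where c: "\<And>x. x \<in> \<Omega> \<Longrightarrow> Du x = - (lam / 2) *\<^sub>R (x - c)"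
    using gradient_affine by blast
  \<comment> \<open>Extended to the closure by continuity, because the formula is to be evaluated on
    the frontier.\<close>
  have Du: "Du x = - (lam / 2) *\<^sub>R (x - c)" if "x \<in> closure \<Omega>" for x
  proof -
    have "continuous_on (closure \<Omega>) (\<lambda>x. Du x + (lam / 2) *\<^sub>R (x - c))"
      by (intro continuous_intros cont_Du)
    then have "Du x + (lam / 2) *\<^sub>R (x - c) = 0"
      by (rule continuous_constant_on_closure[OF _ _ that]) (simp add: c)
    then show ?thesis
      by (simp add: eq_neg_iff_add_eq_0)
  qed
  define w where "w x = u x + lam / 4 * ((x - c) \<bullet> (x - c))" for x
  have cont_w: "continuous_on (closure \<Omega>) w"
    unfolding w_def by (intro continuous_intros cont_u)
  have "w constant_on \<Omega>"
  proof (rule has_derivative_zero_connected_constant_on[OF connected_dom open_dom, of "{}"])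
    show "continuous_on \<Omega> w"
      using cont_w closure_subset by (rule continuous_on_subset)
    show "\<forall>x\<in>\<Omega> - {}. (w has_derivative (\<lambda>h. 0)) (at x within \<Omega>)"
    proof
      fix x assume x: "x \<in> \<Omega> - {}"
      have "(w has_derivative (\<lambda>h. h \<bullet> Du x + lam / 4 * ((x - c) \<bullet> (h - 0) + (h - 0) \<bullet> (x - c)))) (at x)"
        unfolding w_def[abs_def] using x
        by (intro has_derivative_add has_derivative_mult_right has_derivative_inner has_derivative_diff
          has_derivative_ident has_derivative_const grad') auto
      also have "(\<lambda>h. h \<bullet> Du x + lam / 4 * ((x - c) \<bullet> (h - 0) + (h - 0) \<bullet> (x - c))) = (\<lambda>h. 0)"
        using x by (simp add: c inner_commute[of "x - c"])
      finally show "(w has_derivative (\<lambda>h. 0)) (at x within \<Omega>)"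
        by (rule has_derivative_at_withinI)
    qed
  qed simp
  then obtain A where A: "\<And>x. x \<in> \<Omega> \<Longrightarrow> w x = A"
    unfolding constant_on_def by blast
  have wA: "w x = A" if "x \<in> closure \<Omega>" for x
    by (rule continuous_constant_on_closure[OF cont_w A that])
  have "\<Omega> \<noteq> UNIV"
    using bounded_dom not_bounded_UNIV by blast
  then have "frontier \<Omega> \<noteq> {}"
    using frontier_eq_empty nonempty by blast
  have frontier_sub: "frontier \<Omega> \<subseteq> closure \<Omega>"
    by (auto simp: frontier_def)
  \<comment> \<open>Since |Du| = 1 there, the affine formula places the frontier on a single
    circle.\<close>
  have dist: "dist c x = 2 / lam" if "x \<in> frontier \<Omega>" for x
  proof -
    have "norm (Du x) = lam / 2 * dist c x"
      using Du[of x] that frontier_sub lam_pos by (auto simp: dist_norm norm_minus_commute)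
    then show ?thesis
      using boundary_Du[OF that] lam_pos by (simp add: field_simps)
  qed
  obtain p where p: "p \<in> frontier \<Omega>"
    using \<open>frontier \<Omega> \<noteq> {}\<close> by blast
  have w_dist: "w x = u x + lam / 4 * (dist c x)\<^sup>2" for x
    by (simp add: w_def dist_norm norm_minus_commute dot_square_norm)
  have "A = lam / 4 * (2 / lam)\<^sup>2"
    using wA[of p] w_dist[of p] dist[OF p] boundary_u[OF p] p frontier_sub by auto
  then have u: "u x = lam / 4 * ((2 / lam)\<^sup>2 - (dist c x)\<^sup>2)" if "x \<in> closure \<Omega>" for x
    using wA[OF that] w_dist[of x] by (simp add: algebra_simps)
  \<comment> \<open>Positivity of u inside keeps the domain within the circle.\<close>
  have sub: "\<Omega> \<subseteq> ball c (2 / lam)"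
  proof
    fix x assume x: "x \<in> \<Omega>"
    then have "x \<in> closure \<Omega>"
      using closure_subset by auto
    then have "0 < lam / 4 * ((2 / lam)\<^sup>2 - (dist c x)\<^sup>2)"
      using u_pos[OF x] u[of x] by simp
    then have "(dist c x)\<^sup>2 < (2 / lam)\<^sup>2"
      using lam_pos by (simp add: zero_less_mult_iff)
    then show "x \<in> ball c (2 / lam)"
      using lam_pos power2_less_imp_less[of "dist c x" "2 / lam"] by simp
  qed
  have "ball c (2 / lam) \<subseteq> \<Omega>"
  proof (rule ccontr)
    assume "\<not> ball c (2 / lam) \<subseteq> \<Omega>"
    \<comment> \<open>The ball is connected and meets the domain; were it not contained in it, it
      would meet the frontier, whose points all have distance exactly 2 / lam from c.\<close>
    then have "ball c (2 / lam) \<inter> frontier \<Omega> \<noteq> {}"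
      using nonempty sub by (intro connected_Int_frontier) auto
    then show False
      using dist by auto
  qed
  then show ?thesis
    using sub u by blast
qed

lemma area_identity: "2 * lam * (LINT x:\<Omega>|lborel. u x) = measure lborel \<Omega>"
proof -
  have int: "set_integrable lborel \<Omega> u" "set_integrable lborel \<Omega> (\<lambda>x. 1 :: real)"
    by (intro set_integrable_continuous_closure open_dom bounded_dom continuous_intros cont_u)+
  have "(LINT x:\<Omega>|lborel. 2 * lam * u x - 1) = 2 * lam * (LINT x:\<Omega>|lborel. u x) - (LINT x:\<Omega>|lborel. 1)"
    using set_integral_diff(2)[of lborel \<Omega> "\<lambda>x. 2 * lam * u x" "\<lambda>x. 1"] int by simp
  moreover have "(LINT x:\<Omega>|lborel. (1::real)) = measure lborel \<Omega>"
    using open_dom by (simp add: set_lebesgue_integral_def)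
  ultimately show ?thesis
    using pohozaev_identity by simp
qed

end

section \<open>From the steady state to Serrin's problem, and the radius\<close>

theorem theorem3p1:
  fixes V0 lam re :: real
    and F :: "real \<Rightarrow> real"
    and u :: "real^2 \<Rightarrow> real"
    and \<Omega> :: "(real^2) set"
  defines "re \<equiv> root 3 (4 * V0 / pi)"
  assumes "V0 > 0"
    and "smooth_on F {0<..}"
    and "\<forall>s>0. deriv F s > 0"
    and "F 1 = 0"
    and "steady_state F V0 lam u \<Omega>"
  shows "(\<exists>c. \<Omega> = ball c re \<and> frontier \<Omega> = sphere c re \<and>
            (\<forall>x\<in>closure \<Omega>. u x = 1 / 2 * (re - (dist c x)\<^sup>2 / re))) \<and>
         lam = 2 / re"
proof -
  obtain Du D2u where dom: "bounded \<Omega>" "connected \<Omega>" "open \<Omega>"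
    and C2: "C2_closure \<Omega> u Du D2u"
    and lap: "\<And>x. x \<in> \<Omega> \<Longrightarrow> trace (D2u x) = - lam"
    and u0: "\<And>x. x \<in> frontier \<Omega> \<Longrightarrow> u x = 0"
    and vol: "(LINT x:\<Omega>|lebesgue. u x) = V0"
    and F0: "\<And>x. x \<in> frontier \<Omega> \<Longrightarrow> norm (Du x) > 0 \<and> F (norm (Du x)) = 0"
    using \<open>steady_state F V0 lam u \<Omega>\<close> unfolding steady_state_def by fastforce
  have cont_u: "continuous_on (closure \<Omega>) u"
    using C2 by (simp add: C2_closure_def)
  \<comment> \<open>The volume is a Lebesgue integral; for a Borel measurable integrand it agrees
    with the integral over \<open>lborel\<close>.\<close>
  have "set_borel_measurable lborel \<Omega> u"
    using set_integrable_continuous_closure[OF dom(3,1) cont_u]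
    by (auto simp: set_integrable_def set_borel_measurable_def)
  then have V0: "(LINT x:\<Omega>|lborel. u x) = V0"
    using vol by (simp add: set_lebesgue_integral_def set_borel_measurable_def integral_completion)
  have "\<Omega> \<noteq> {}"
    using V0 \<open>V0 > 0\<close> by (auto simp: set_lebesgue_integral_def)
  have "F differentiable_on {0<..}"
    using \<open>smooth_on F {0<..}\<close> unfolding smooth_on_def Ck_on_def
    by (metis funpow_0 less_Suc0)
  then have F_deriv: "(F has_real_derivative deriv F s) (at s)" if "s > 0" for s
  proof -
    have "F differentiable (at s)"
      using that \<open>F differentiable_on {0<..}\<close> by (metis differentiable_on_eq_differentiable_at greaterThan_iff open_greaterThan)
    then show ?thesis
      by (simp add: DERIV_deriv_iff_real_differentiable)
  qed
  have F_mono: "F s < F t" if "0 < s" "s < t" for s t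
  proof (rule DERIV_pos_imp_increasing[OF \<open>s < t\<close>])
    fix x assume "s \<le> x"
    then have "x > 0"
      using \<open>0 < s\<close> by simp
    then show "\<exists>y. (F has_real_derivative y) (at x) \<and> y > 0"
      using F_deriv assms(4) by blast
  qed
  have norm_Du: "norm (Du x) = 1" if "x \<in> frontier \<Omega>" for x
    using F0[OF that] F_mono[of "norm (Du x)" 1] F_mono[of 1 "norm (Du x)"] \<open>F 1 = 0\<close>
    by (cases "norm (Du x)" "1 :: real" rule: linorder_cases) auto
  \<comment> \<open>Otherwise u is subharmonic with zero boundary values, hence nonpositive, against
    V0 > 0. Adding k |x|^2, whose Laplacian is 4 k, makes the maximum principle strict.\<close>
  have "lam > 0"
  proof (rule ccontr)
    assume "\<not> lam > 0"
    obtain R where R: "R > 0" "\<And>x. x \<in> closure \<Omega> \<Longrightarrow> norm x \<le> R"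
      using bounded_closure[OF dom(1)] unfolding bounded_pos by blast
    have "u x \<le> 0" if x: "x \<in> \<Omega>" for x
    proof -
      have "u x \<le> e" if "e > 0" for e
      proof -
        \<comment> \<open>Chosen so that the perturbation is at most e on the closure.\<close>
        define k where "k = e / R\<^sup>2"
        have k: "k > 0" "k * R\<^sup>2 = e"
          using that R(1) by (auto simp: k_def)
        obtain y where y: "y \<in> frontier \<Omega>" "u x + k * (x \<bullet> x) < u y + k * (y \<bullet> y)"
        proof (rule strict_maximum_principle[of \<Omega> "\<lambda>x. u x + k * (x \<bullet> x)" "\<lambda>x. Du x + (2 * k) *\<^sub>R x"
              "\<lambda>x h. D2u x *v h + (2 * k) *\<^sub>R h" x])
          show "GDERIV (\<lambda>x. u x + k * (x \<bullet> x)) x :> Du x + (2 * k) *\<^sub>R x" if "x \<in> \<Omega>" for x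
          proof -
            have "(u has_derivative (\<lambda>h. h \<bullet> Du x)) (at x)"
              using C2 that by (simp add: C2_closure_def gderiv_def)
            then have "((\<lambda>x. u x + k * (x \<bullet> x)) has_derivative (\<lambda>h. h \<bullet> Du x + k * (x \<bullet> h + h \<bullet> x))) (at x)"
              by (intro has_derivative_add has_derivative_mult_right has_derivative_inner has_derivative_ident)
            then show ?thesis
              by (simp add: gderiv_def inner_add_right inner_commute algebra_simps)
          qed
          show "((\<lambda>x. Du x + (2 * k) *\<^sub>R x) has_derivative (\<lambda>h. D2u x *v h + (2 * k) *\<^sub>R h)) (at x)"
            if "x \<in> \<Omega>" for x
            using C2 that unfolding C2_closure_def
            by (intro has_derivative_add has_derivative_scaleR_right has_derivative_ident) auto
          show "tr (\<lambda>h. D2u x *v h + (2 * k) *\<^sub>R h) > 0" if "x \<in> \<Omega>" for x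
            unfolding tr_add tr_scaleR tr_id tr_matrix lap[OF that] using k \<open>\<not> lam > 0\<close> by simp
        qed (use x dom cont_u in \<open>auto intro!: continuous_intros\<close>)
        have "k * (y \<bullet> y) \<le> k * R\<^sup>2"
          using R(2)[of y] y(1) k(1) by (auto simp: dot_square_norm frontier_def intro!: mult_left_mono power_mono)
        moreover have "k * (x \<bullet> x) \<ge> 0"
          using k(1) by simp
        ultimately show ?thesis
          using y u0[OF y(1)] k(2) by linarith
      qed
      then show ?thesis
        by (rule dense_ge)
    qed
    then have "0 \<le> (LINT x|lborel. - (indicator \<Omega> x *\<^sub>R u x))"
      by (intro Bochner_Integration.integral_nonneg) (auto simp: indicator_def)
    then have "(LINT x:\<Omega>|lborel. u x) \<le> 0"
      by (simp add: set_lebesgue_integral_def)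
    then show False
      using V0 \<open>V0 > 0\<close> by simp
  qed
  interpret serrin_domain \<Omega> u Du D2u lam
    by unfold_locales (use dom \<open>\<Omega> \<noteq> {}\<close> C2 lap u0 norm_Du \<open>lam > 0\<close> in auto)
  obtain c where c: "\<Omega> = ball c (2 / lam)"
    "\<And>x. x \<in> closure \<Omega> \<Longrightarrow> u x = lam / 4 * ((2 / lam)\<^sup>2 - (dist c x)\<^sup>2)"
    using serrin by blast
  define r where "r = 2 / lam"
  have r: "r > 0" "lam = 2 / r"
    using \<open>lam > 0\<close> by (auto simp: r_def)
  have "measure lborel \<Omega> = r\<^sup>2 * pi"
    using circle_area[of r c] r(1) by (simp add: c(1) r_def)
  \<comment> \<open>The area identity with lam = 2 / r reads 4 V0 / r = pi r^2, which determines
    r.\<close>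
  then have "2 * lam * V0 = r\<^sup>2 * pi"
    using area_identity unfolding V0 by simp
  then have "r ^ 3 = 4 * V0 / pi"
    using r by (simp add: field_simps power2_eq_square power3_eq_cube)
  then have "re = r"
    using r(1) real_root_pos2[of 3 r] by (simp add: re_def)
  moreover have "u x = 1 / 2 * (r - (dist c x)\<^sup>2 / r)" if "x \<in> closure \<Omega>" for x
    using c(2)[OF that] r by (simp add: field_simps power2_eq_square)
  ultimately show ?thesis
    using c(1) r by (auto simp: r_def[symmetric] frontier_ball intro!: exI[of _ c])
qed

end
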